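(* Let $A=A_\Phi$ be the Bondal--Ruan homotopy path algebra of a cohomologically proper toric stack $\mathfrak X=[\mathbb A^{n+k}/G]$. If $A$ is directable, then $A$ is Koszul.
   Context: $\mathsf k$ is a unital commutative Noetherian base ring. $G\subseteq GL_{n+k}$ is a diagonalizable group acting diagonally on $\mathbb A^{n+k}$, $\widehat G=\mathrm{Hom}(G,\mathbb G_m)$, and $0\to M\to\mathbb Z^{n+k}\xrightarrow{\mu}\widehat G\to0$ is the dual exact sequence, with $M$ of rank $n$ and $D_1,\dots,D_{n+k}$ the standard basis. $\mathfrak X$ is cohomologically proper if $\mu_{\mathbb R}(\mathbb R_{\ge0}^{n+k})$ is a strongly convex cone in $\widehat G_{\mathbb R}$ and no $\mu(D_i)$ is torsion. With $\mathbb T^n=M_{\mathbb R}/M$, $M_{\mathbb R}=\ker\mu_{\mathbb R}\subset\mathbb R^{n+k}$, let $\Phi:\mathbb T^n\to\widehat G$, $\Phi(\sum a_iD_i+M)=\mu(-\sum\lfloor a_i\rfloor D_i)$; its image is finite. $\mathcal O(-D)$ is the line bundle on $\mathfrak X$ attached to $\mu(-D)$; $\mathrm{Hom}(\mathcal O(-D),\mathcal O(-E))$ has as basis the monomials $x^u$, $u\in\mathbb Z_{\ge0}^{n+k}$, with $\mu(u)=\mu(D-E)$. $A_\Phi=\mathrm{End}(\bigoplus_{\mu(D)\in\mathrm{Im}\,\Phi}\mathcal O_{\mathfrak X}(-D))$ (one summand per element of $\mathrm{Im}\,\Phi$), regarded as a quiver algebra with vertex set $\mathrm{Im}\,\Phi$,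 arrows the indecomposable monomial morphisms, and relations identifying two parallel paths iff their monomials agree; products of paths are written in order of concatenation. Directable: (the arrows of the quiver being multiplications by the variables $x_i$) there is a relabeling of the variables, $x_1<\dots<x_{n+k}$, such that any concatenation of arrows $x_{i_1}\cdots x_{i_m}$ is equal in $A$ to a concatenation of arrows in which the same variables appear in weakly increasing order. Koszul: the relations are homogeneous for path length and $A$ has a graded projective $(A,A)$-bimodule resolution whose $i$-th term is generated in degree $i$ (the minimal resolution has differentials linear in the arrows). *)

theory Defs
  imports "HOL-Analysis.Analysis" "HOL-Analysis.Finite_Function_Topology" "HOL-Combinatorics.Permutations"
begin

section \<open>Noetherian commutative rings\<close>

text \<open>\<open>module.subspace (*)\<close> singles out the ideals, the submodules of the ring as a module over itself.\<close>

definition noetherian :: "'r::comm_ring_1 itself \<Rightarrow> bool" where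
  "noetherian _ \<longleftrightarrow> (\<forall>I::'r set. module.subspace (*) I \<longrightarrow> (\<exists>S. finite S \<and> I = module.span (*) S))"


section \<open>The real vector space generated by an abelian group\<close>

text \<open>\<open>'g real_tensor\<close> is the tensor product of the abelian group \<open>'g\<close> with the reals: the free
  real vector space on the elements of \<open>'g\<close>, modulo additivity.\<close>

definition tensor_relations :: "('g::ab_group_add \<Rightarrow>\<^sub>0 real) set" where
  "tensor_relations = span {Poly_Mapping.single (g + h) 1 - Poly_Mapping.single g 1
     - Poly_Mapping.single h 1 | g h. True}"

quotient_type (overloaded) 'g real_tensor = "'g::ab_group_add \<Rightarrow>\<^sub>0 real" /
  "\<lambda>x y. x - y \<in> tensor_relations"
proof (rule equivpI)
  show "reflp (\<lambda>x y. x - y \<in> (tensor_relations :: ('g \<Rightarrow>\<^sub>0 real) set))"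
    by (auto simp: reflp_def tensor_relations_def span_zero)
  show "symp (\<lambda>x y. x - y \<in> (tensor_relations :: ('g \<Rightarrow>\<^sub>0 real) set))"
  proof (rule sympI)
    fix x y :: "'g \<Rightarrow>\<^sub>0 real"
    assume "x - y \<in> tensor_relations"
    then have "- (x - y) \<in> tensor_relations"
      unfolding tensor_relations_def by (rule span_neg)
    then show "y - x \<in> tensor_relations" by simp
  qed
  show "transp (\<lambda>x y. x - y \<in> (tensor_relations :: ('g \<Rightarrow>\<^sub>0 real) set))"
  proof (rule transpI)
    fix x y z :: "'g \<Rightarrow>\<^sub>0 real"
    assume "x - y \<in> tensor_relations" "y - z \<in> tensor_relations"
    then have "(x - y) + (y - z) \<in> tensor_relations"
      unfolding tensor_relations_def by (rule span_add)
    then show "x - z \<in> tensor_relations" by simp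
  qed
qed

instantiation real_tensor :: (ab_group_add) real_vector
begin

lift_definition zero_real_tensor :: "'a real_tensor" is 0 .

lift_definition plus_real_tensor :: "'a real_tensor \<Rightarrow> 'a real_tensor \<Rightarrow> 'a real_tensor" is "(+)"
proof -
  fix a b c d :: "'a \<Rightarrow>\<^sub>0 real"
  assume "a - b \<in> tensor_relations" "c - d \<in> tensor_relations"
  then have "(a - b) + (c - d) \<in> tensor_relations"
    unfolding tensor_relations_def by (rule span_add)
  then show "(a + c) - (b + d) \<in> tensor_relations"
    by (simp add: algebra_simps)
qed

lift_definition uminus_real_tensor :: "'a real_tensor \<Rightarrow> 'a real_tensor" is uminus
proof -
  fix a b :: "'a \<Rightarrow>\<^sub>0 real"
  assume "a - b \<in> tensor_relations"
  then have "- (a - b) \<in> tensor_relations"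
    unfolding tensor_relations_def by (rule span_neg)
  then show "- a - (- b) \<in> tensor_relations"
    by (simp add: algebra_simps)
qed

lift_definition minus_real_tensor :: "'a real_tensor \<Rightarrow> 'a real_tensor \<Rightarrow> 'a real_tensor" is "(-)"
proof -
  fix a b c d :: "'a \<Rightarrow>\<^sub>0 real"
  assume "a - b \<in> tensor_relations" "c - d \<in> tensor_relations"
  then have "(a - b) - (c - d) \<in> tensor_relations"
    unfolding tensor_relations_def by (rule span_diff)
  then show "(a - c) - (b - d) \<in> tensor_relations"
    by (simp add: algebra_simps)
qed

lift_definition scaleR_real_tensor :: "real \<Rightarrow> 'a real_tensor \<Rightarrow> 'a real_tensor" is scaleR
proof -
  fix r :: real and a b :: "'a \<Rightarrow>\<^sub>0 real"
  assume "a - b \<in> tensor_relations"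
  then have "r *\<^sub>R (a - b) \<in> tensor_relations"
    unfolding tensor_relations_def by (rule span_scale)
  then show "r *\<^sub>R a - r *\<^sub>R b \<in> tensor_relations"
    by (simp add: scaleR_diff_right)
qed

instance
proof
  have eq: "u - v \<in> tensor_relations" if "u = v" for u v :: "'a \<Rightarrow>\<^sub>0 real"
    using that by (simp add: tensor_relations_def span_zero)
  fix a b c :: "'a real_tensor" and r s :: real
  show "a + b + c = a + (b + c)" by transfer (rule eq, simp add: add.assoc)
  show "a + b = b + a" by transfer (rule eq, simp add: add.commute)
  show "0 + a = a" by transfer (rule eq, simp)
  show "- a + a = 0" by transfer (rule eq, simp)
  show "a - b = a + - b" by transfer (rule eq, simp)
  show "r *\<^sub>R (a + b) = r *\<^sub>R a + r *\<^sub>R b" by transfer (rule eq, simp add: scaleR_add_right)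
  show "(r + s) *\<^sub>R a = r *\<^sub>R a + s *\<^sub>R a" by transfer (rule eq, simp add: scaleR_add_left)
  show "r *\<^sub>R s *\<^sub>R a = (r * s) *\<^sub>R a" by transfer (rule eq, simp)
  show "1 *\<^sub>R a = a" by transfer (rule eq, simp)
qed

end

lift_definition to_real_tensor :: "'g::ab_group_add \<Rightarrow> 'g real_tensor" is
  "\<lambda>g. Poly_Mapping.single g 1" .


section \<open>Toric quotient stacks of affine space\<close>

text \<open>A diagonalizable group acting diagonally on affine \<open>N\<close>-space is recorded by the homomorphism
  \<open>mu\<close> from the lattice of rank \<open>N\<close> onto its character group. Vectors with \<open>N\<close> entries are finitely
  supported functions on \<open>nat\<close> whose support lies in \<open>{..<N}\<close>, and the \<open>i\<close>-th standard basis vector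
  is \<open>Poly_Mapping.single i 1\<close>.\<close>

definition vecs :: "nat \<Rightarrow> (nat \<Rightarrow>\<^sub>0 'a::zero) set" where
  "vecs N = {u. Poly_Mapping.keys u \<subseteq> {..<N}}"

definition kernel_lattice :: "nat \<Rightarrow> ((nat \<Rightarrow>\<^sub>0 int) \<Rightarrow> 'g::ab_group_add) \<Rightarrow> (nat \<Rightarrow>\<^sub>0 int) set" where
  "kernel_lattice N mu = {u \<in> vecs N. mu u = 0}"

locale toric_stack =
  fixes n k :: nat and mu :: "(nat \<Rightarrow>\<^sub>0 int) \<Rightarrow> 'g::ab_group_add"
  assumes mu_add: "u \<in> vecs (n + k) \<Longrightarrow> v \<in> vecs (n + k) \<Longrightarrow> mu (u + v) = mu u + mu v"
    and mu_surj: "mu ` vecs (n + k) = UNIV"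
    and kernel_rank: "\<exists>b :: nat \<Rightarrow> nat \<Rightarrow>\<^sub>0 int. b ` {..<n} \<subseteq> kernel_lattice (n + k) mu \<and>
      (\<forall>m \<in> kernel_lattice (n + k) mu. \<exists>!c. c \<in> vecs n \<and>
         m = (\<Sum>j<n. frag_cmul (Poly_Mapping.lookup c j) (b j)))"

definition mu_real :: "nat \<Rightarrow> ((nat \<Rightarrow>\<^sub>0 int) \<Rightarrow> 'g::ab_group_add) \<Rightarrow> (nat \<Rightarrow>\<^sub>0 real) \<Rightarrow> 'g real_tensor" where
  "mu_real N mu a =
     (\<Sum>i<N. Poly_Mapping.lookup a i *\<^sub>R to_real_tensor (mu (Poly_Mapping.single i 1)))"

definition torsion :: "'g::ab_group_add \<Rightarrow> bool" where
  "torsion g \<longleftrightarrow> (\<exists>m::nat>0. (\<Sum>_<m. g) = 0)"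

definition strongly_convex_cone :: "'v::real_vector set \<Rightarrow> bool" where
  "strongly_convex_cone S \<longleftrightarrow> cone S \<and> convex S \<and> S \<inter> uminus ` S = {0}"

definition cohomologically_proper :: "nat \<Rightarrow> ((nat \<Rightarrow>\<^sub>0 int) \<Rightarrow> 'g::ab_group_add) \<Rightarrow> bool" where
  "cohomologically_proper N mu \<longleftrightarrow>
     strongly_convex_cone (mu_real N mu ` {a \<in> vecs N. \<forall>i. Poly_Mapping.lookup a i \<ge> 0}) \<and>
     (\<forall>i<N. \<not> torsion (mu (Poly_Mapping.single i 1)))"

definition kernel_real :: "nat \<Rightarrow> ((nat \<Rightarrow>\<^sub>0 int) \<Rightarrow> 'g::ab_group_add) \<Rightarrow> (nat \<Rightarrow>\<^sub>0 real) set" where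
  "kernel_real N mu = {a \<in> vecs N. mu_real N mu a = 0}"

text \<open>The map \<open>Phi\<close> on the torus, given on representatives in \<open>kernel_real N mu\<close>; translating
  \<open>a\<close> by an element of \<open>kernel_lattice N mu\<close> does not change \<open>Phi mu a\<close>.\<close>

definition Phi :: "((nat \<Rightarrow>\<^sub>0 int) \<Rightarrow> 'g::ab_group_add) \<Rightarrow> (nat \<Rightarrow>\<^sub>0 real) \<Rightarrow> 'g" where
  "Phi mu a = mu (- Poly_Mapping.map floor a)"

definition im_Phi :: "nat \<Rightarrow> ((nat \<Rightarrow>\<^sub>0 int) \<Rightarrow> 'g::ab_group_add) \<Rightarrow> 'g set" where
  "im_Phi N mu = Phi mu ` kernel_real N mu"


section \<open>Monomial morphisms, arrows and paths\<close>

text \<open>\<open>(v, u, w)\<close> with \<open>v = mu D\<close> and \<open>w = mu E\<close> stands for the monomial \<open>x^u\<close> seen as a morphism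
  from \<open>O(-D)\<close> to \<open>O(-E)\<close>.\<close>

type_synonym 'g mono_mor = "'g \<times> (nat \<Rightarrow>\<^sub>0 nat) \<times> 'g"

definition src :: "'g mono_mor \<Rightarrow> 'g" where "src p = fst p"
definition expo :: "'g mono_mor \<Rightarrow> (nat \<Rightarrow>\<^sub>0 nat)" where "expo p = fst (snd p)"
definition tgt :: "'g mono_mor \<Rightarrow> 'g" where "tgt p = snd (snd p)"

definition concat_mor :: "'g mono_mor \<Rightarrow> 'g mono_mor \<Rightarrow> 'g mono_mor" where
  "concat_mor p q = (src p, expo p + expo q, tgt q)"

definition mono_mors :: "nat \<Rightarrow> ((nat \<Rightarrow>\<^sub>0 int) \<Rightarrow> 'g::ab_group_add) \<Rightarrow> 'g mono_mor set" where
  "mono_mors N mu = {(v, u, w). v \<in> im_Phi N mu \<and> w \<in> im_Phi N mu \<and> u \<in> vecs N \<and>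
     mu (Poly_Mapping.map int u) = v - w}"

definition arrows :: "nat \<Rightarrow> ((nat \<Rightarrow>\<^sub>0 int) \<Rightarrow> 'g::ab_group_add) \<Rightarrow> 'g mono_mor set" where
  "arrows N mu = {a \<in> mono_mors N mu. expo a \<noteq> 0 \<and>
     \<not> (\<exists>p \<in> mono_mors N mu. \<exists>q \<in> mono_mors N mu.
          expo p \<noteq> 0 \<and> expo q \<noteq> 0 \<and> tgt p = src q \<and> a = concat_mor p q)}"

fun is_path :: "nat \<Rightarrow> ((nat \<Rightarrow>\<^sub>0 int) \<Rightarrow> 'g::ab_group_add) \<Rightarrow> 'g \<Rightarrow> 'g mono_mor list \<Rightarrow> 'g \<Rightarrow> bool" where
  "is_path N mu v [] w \<longleftrightarrow> v \<in> im_Phi N mu \<and> v = w"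
| "is_path N mu v (a # as) w \<longleftrightarrow> a \<in> arrows N mu \<and> src a = v \<and> is_path N mu (tgt a) as w"

definition path_expo :: "'g mono_mor list \<Rightarrow> (nat \<Rightarrow>\<^sub>0 nat)" where
  "path_expo as = sum_list (map expo as)"

text \<open>Two parallel paths are equal in the algebra iff their \<open>path_expo\<close> agree.\<close>

definition homogeneous_relations :: "nat \<Rightarrow> ((nat \<Rightarrow>\<^sub>0 int) \<Rightarrow> 'g::ab_group_add) \<Rightarrow> bool" where
  "homogeneous_relations N mu \<longleftrightarrow> (\<forall>v w as bs. is_path N mu v as w \<longrightarrow> is_path N mu v bs w \<longrightarrow>
     path_expo as = path_expo bs \<longrightarrow> length as = length bs)"

definition path_length :: "nat \<Rightarrow> ((nat \<Rightarrow>\<^sub>0 int) \<Rightarrow> 'g::ab_group_add) \<Rightarrow> 'g mono_mor \<Rightarrow> nat" where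
  "path_length N mu p =
     (LEAST d. \<exists>as. is_path N mu (src p) as (tgt p) \<and> path_expo as = expo p \<and> length as = d)"

text \<open>The word \<open>is\<close> lists the indices of the variables along a path. The permutation \<open>s\<close> is the
  relabeling: \<open>x_i < x_j\<close> iff \<open>s i < s j\<close>.\<close>

definition spells :: "'g mono_mor list \<Rightarrow> nat list \<Rightarrow> bool" where
  "spells as is \<longleftrightarrow> map expo as = map (\<lambda>i. Poly_Mapping.single i 1) is"

definition directable :: "nat \<Rightarrow> ((nat \<Rightarrow>\<^sub>0 int) \<Rightarrow> 'g::ab_group_add) \<Rightarrow> bool" where
  "directable N mu \<longleftrightarrow>
     (\<forall>a \<in> arrows N mu. \<exists>i<N. expo a = Poly_Mapping.single i 1) \<and>
     (\<exists>s. s permutes {..<N} \<and>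
        (\<forall>v w as is. is_path N mu v as w \<longrightarrow> spells as is \<longrightarrow>
           (\<exists>bs js. is_path N mu v bs w \<and> spells bs js \<and> path_expo bs = path_expo as \<and>
              mset js = mset is \<and> sorted (map s js))))"


section \<open>Graded algebras and graded bimodules\<close>

record ('r, 'a) graded_algebra =
  acar :: "'a set"
  amult :: "'a \<Rightarrow> 'a \<Rightarrow> 'a"
  aone :: 'a
  ascale :: "'r \<Rightarrow> 'a \<Rightarrow> 'a"
  acomp :: "nat \<Rightarrow> 'a set"

record ('a, 'm) graded_bimod =
  mcar :: "'m set"
  lact :: "'a \<Rightarrow> 'm \<Rightarrow> 'm"
  ract :: "'m \<Rightarrow> 'a \<Rightarrow> 'm"
  mcomp :: "nat \<Rightarrow> 'm set"

definition additive_subgroup :: "'m::ab_group_add set \<Rightarrow> bool" where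
  "additive_subgroup S \<longleftrightarrow> 0 \<in> S \<and> (\<forall>x\<in>S. \<forall>y\<in>S. x + y \<in> S) \<and> (\<forall>x\<in>S. - x \<in> S)"

definition is_grading :: "'m::ab_group_add set \<Rightarrow> (nat \<Rightarrow> 'm set) \<Rightarrow> bool" where
  "is_grading C H \<longleftrightarrow> (\<forall>d. additive_subgroup (H d) \<and> H d \<subseteq> C) \<and>
     (\<forall>x\<in>C. \<exists>!f :: nat \<Rightarrow>\<^sub>0 'm. (\<forall>d. Poly_Mapping.lookup f d \<in> H d) \<and>
        x = (\<Sum>d\<in>Poly_Mapping.keys f. Poly_Mapping.lookup f d))"

text \<open>The axiom \<open>central\<close> says that the base ring acts in the same way from both sides, so that these
  are modules over the enveloping algebra of \<open>A\<close>.\<close>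

locale graded_bimodule =
  fixes A :: "('r, 'a::ab_group_add) graded_algebra"
    and P :: "('a, 'm::ab_group_add) graded_bimod"
  assumes subgroup: "additive_subgroup (mcar P)"
    and lact_closed: "a \<in> acar A \<Longrightarrow> x \<in> mcar P \<Longrightarrow> lact P a x \<in> mcar P"
    and ract_closed: "a \<in> acar A \<Longrightarrow> x \<in> mcar P \<Longrightarrow> ract P x a \<in> mcar P"
    and lact_add_left: "a \<in> acar A \<Longrightarrow> b \<in> acar A \<Longrightarrow> x \<in> mcar P \<Longrightarrow>
      lact P (a + b) x = lact P a x + lact P b x"
    and lact_add_right: "a \<in> acar A \<Longrightarrow> x \<in> mcar P \<Longrightarrow> y \<in> mcar P \<Longrightarrow>
      lact P a (x + y) = lact P a x + lact P a y"
    and ract_add_left: "a \<in> acar A \<Longrightarrow> x \<in> mcar P \<Longrightarrow> y \<in> mcar P \<Longrightarrow>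
      ract P (x + y) a = ract P x a + ract P y a"
    and ract_add_right: "a \<in> acar A \<Longrightarrow> b \<in> acar A \<Longrightarrow> x \<in> mcar P \<Longrightarrow>
      ract P x (a + b) = ract P x a + ract P x b"
    and lact_assoc: "a \<in> acar A \<Longrightarrow> b \<in> acar A \<Longrightarrow> x \<in> mcar P \<Longrightarrow>
      lact P (amult A a b) x = lact P a (lact P b x)"
    and ract_assoc: "a \<in> acar A \<Longrightarrow> b \<in> acar A \<Longrightarrow> x \<in> mcar P \<Longrightarrow>
      ract P x (amult A a b) = ract P (ract P x a) b"
    and lact_ract: "a \<in> acar A \<Longrightarrow> b \<in> acar A \<Longrightarrow> x \<in> mcar P \<Longrightarrow>
      ract P (lact P a x) b = lact P a (ract P x b)"
    and lact_one: "x \<in> mcar P \<Longrightarrow> lact P (aone A) x = x"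
    and ract_one: "x \<in> mcar P \<Longrightarrow> ract P x (aone A) = x"
    and central: "x \<in> mcar P \<Longrightarrow> lact P (ascale A c (aone A)) x = ract P x (ascale A c (aone A))"
    and grading: "is_grading (mcar P) (mcomp P)"
    and lact_degree: "a \<in> acomp A d \<Longrightarrow> x \<in> mcomp P e \<Longrightarrow> lact P a x \<in> mcomp P (d + e)"
    and ract_degree: "a \<in> acomp A d \<Longrightarrow> x \<in> mcomp P e \<Longrightarrow> ract P x a \<in> mcomp P (e + d)"

definition graded_hom ::
  "('r, 'a) graded_algebra \<Rightarrow> ('a, 'm::ab_group_add) graded_bimod \<Rightarrow>
   ('a, 'l::ab_group_add) graded_bimod \<Rightarrow> ('m \<Rightarrow> 'l) \<Rightarrow> bool" where
  "graded_hom A P Q f \<longleftrightarrow> f ` mcar P \<subseteq> mcar Q \<and>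
     (\<forall>x\<in>mcar P. \<forall>y\<in>mcar P. f (x + y) = f x + f y) \<and>
     (\<forall>a\<in>acar A. \<forall>x\<in>mcar P. f (lact P a x) = lact Q a (f x) \<and> f (ract P x a) = ract Q (f x) a) \<and>
     (\<forall>d. f ` mcomp P d \<subseteq> mcomp Q d)"

definition generated_in_degree ::
  "('r, 'a) graded_algebra \<Rightarrow> ('a, 'm::ab_group_add) graded_bimod \<Rightarrow> nat \<Rightarrow> bool" where
  "generated_in_degree A P i \<longleftrightarrow>
     (\<forall>S. additive_subgroup S \<longrightarrow> S \<subseteq> mcar P \<longrightarrow> mcomp P i \<subseteq> S \<longrightarrow>
        (\<forall>a\<in>acar A. \<forall>x\<in>S. lact P a x \<in> S \<and> ract P x a \<in> S) \<longrightarrow> S = mcar P)"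

definition regular_bimod :: "('r, 'a) graded_algebra \<Rightarrow> ('a, 'a) graded_bimod" where
  "regular_bimod A = \<lparr>mcar = acar A, lact = amult A, ract = amult A, mcomp = acomp A\<rparr>"


section \<open>The Bondal-Ruan algebra\<close>

text \<open>The algebra is free over the base ring on the monomial morphisms, with products in order of
  concatenation, graded by path length.\<close>

definition bondal_ruan_algebra :: "nat \<Rightarrow> ((nat \<Rightarrow>\<^sub>0 int) \<Rightarrow> 'g::ab_group_add) \<Rightarrow>
    ('r::comm_ring_1, 'g mono_mor \<Rightarrow>\<^sub>0 'r) graded_algebra" where
  "bondal_ruan_algebra N mu = \<lparr>
     acar = {f. Poly_Mapping.keys f \<subseteq> mono_mors N mu},
     amult = (\<lambda>f g. \<Sum>p\<in>Poly_Mapping.keys f. \<Sum>q\<in>Poly_Mapping.keys g.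
        if tgt p = src q
        then Poly_Mapping.single (concat_mor p q) (Poly_Mapping.lookup f p * Poly_Mapping.lookup g q)
        else 0),
     aone = (\<Sum>v\<in>im_Phi N mu. Poly_Mapping.single (v, 0, v) 1),
     ascale = (\<lambda>c. Poly_Mapping.map ((*) c)),
     acomp = (\<lambda>d. {f. Poly_Mapping.keys f \<subseteq> {p \<in> mono_mors N mu. path_length N mu p = d}})\<rparr>"

text \<open>The free graded bimodule on generators indexed by \<open>J\<close>, the \<open>j\<close>-th one in degree \<open>deg j\<close>: the
  direct sum of shifted copies of the tensor square of the algebra over the base ring.
  The triple \<open>(p, j, q)\<close> stands for \<open>p \<otimes> q\<close> in the \<open>j\<close>-th copy.\<close>

definition free_bimod :: "nat \<Rightarrow> ((nat \<Rightarrow>\<^sub>0 int) \<Rightarrow> 'g::ab_group_add) \<Rightarrow> nat set \<Rightarrow> (nat \<Rightarrow> nat) \<Rightarrow>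
    ('g mono_mor \<Rightarrow>\<^sub>0 'r::comm_ring_1, ('g mono_mor \<times> nat \<times> 'g mono_mor) \<Rightarrow>\<^sub>0 'r) graded_bimod" where
  "free_bimod N mu J deg = \<lparr>
     mcar = {x. Poly_Mapping.keys x \<subseteq> mono_mors N mu \<times> J \<times> mono_mors N mu},
     lact = (\<lambda>f x. \<Sum>r\<in>Poly_Mapping.keys f. \<Sum>(p, j, q)\<in>Poly_Mapping.keys x.
        if tgt r = src p
        then Poly_Mapping.single (concat_mor r p, j, q)
          (Poly_Mapping.lookup f r * Poly_Mapping.lookup x (p, j, q))
        else 0),
     ract = (\<lambda>x f. \<Sum>(p, j, q)\<in>Poly_Mapping.keys x. \<Sum>r\<in>Poly_Mapping.keys f.
        if tgt q = src r
        then Poly_Mapping.single (p, j, concat_mor q r)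
          (Poly_Mapping.lookup x (p, j, q) * Poly_Mapping.lookup f r)
        else 0),
     mcomp = (\<lambda>d. {x. Poly_Mapping.keys x \<subseteq> {(p, j, q). p \<in> mono_mors N mu \<and> j \<in> J \<and>
        q \<in> mono_mors N mu \<and> path_length N mu p + deg j + path_length N mu q = d}})\<rparr>"

text \<open>A graded bimodule is projective if it is a direct summand of a free one. Countably many
  generators suffice below: a graded projective bimodule occurring as \<open>i\<close>-th term of a resolution
  with terms generated in degree \<open>i\<close> is finitely generated. For the same reason the terms of the
  resolution may be carried by the type of the free bimodules.\<close>

definition projective_bimod :: "nat \<Rightarrow> ((nat \<Rightarrow>\<^sub>0 int) \<Rightarrow> 'g::ab_group_add) \<Rightarrow>
    ('g mono_mor \<Rightarrow>\<^sub>0 'r::comm_ring_1, 'm::ab_group_add) graded_bimod \<Rightarrow> bool" where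
  "projective_bimod N mu P \<longleftrightarrow> (\<exists>J deg s r.
     graded_hom (bondal_ruan_algebra N mu) P (free_bimod N mu J deg) s \<and>
     graded_hom (bondal_ruan_algebra N mu) (free_bimod N mu J deg) P r \<and>
     (\<forall>x\<in>mcar P. r (s x) = x))"

definition koszul :: "'r::comm_ring_1 itself \<Rightarrow> nat \<Rightarrow> ((nat \<Rightarrow>\<^sub>0 int) \<Rightarrow> 'g::ab_group_add) \<Rightarrow> bool" where
  "koszul _ N mu \<longleftrightarrow> homogeneous_relations N mu \<and>
     (let A = (bondal_ruan_algebra N mu :: ('r, 'g mono_mor \<Rightarrow>\<^sub>0 'r) graded_algebra) in
      \<exists>(P :: nat \<Rightarrow> ('g mono_mor \<Rightarrow>\<^sub>0 'r, ('g mono_mor \<times> nat \<times> 'g mono_mor) \<Rightarrow>\<^sub>0 'r) graded_bimod) d e.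
        (\<forall>i. graded_bimodule A (P i) \<and> projective_bimod N mu (P i) \<and> generated_in_degree A (P i) i) \<and>
        (\<forall>i. graded_hom A (P (Suc i)) (P i) (d i)) \<and>
        graded_hom A (P 0) (regular_bimod A) e \<and>
        e ` mcar (P 0) = acar A \<and>
        {x \<in> mcar (P 0). e x = 0} = d 0 ` mcar (P 1) \<and>
        (\<forall>i. {x \<in> mcar (P (Suc i)). d i x = 0} = d (Suc i) ` mcar (P (Suc (Suc i)))))"

end

theory Submission
  imports Defs
begin

text \<open>Fix a morphism of \<open>A\<close> with source \<open>v\<close> and exponent \<open>u\<close>. The lattice points \<open>c\<close> of the box \<open>[0, u]\<close>
  with \<open>v - mu c\<close> in the image of \<open>Phi\<close> span a cubical complex, and the cubes of dimension \<open>i\<close> for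
  all such boxes together form a basis of a projective bimodule generated in degree \<open>i\<close>: the part of
  the Koszul bimodule resolution of the polynomial ring that is supported on the vertices of the
  quiver. Directability provides a path in this complex from each of its points to the corner \<open>u\<close>
  which uses up the least variable first, then the next one, and so on. Pushing cubes in the least
  direction that is still available therefore contracts the complex to \<open>u\<close>, so that the bimodules
  form a linear resolution of \<open>A\<close>.\<close>


section \<open>Linear extension of maps between free modules\<close>

text \<open>Sorting is available for the path from each corner of the cube to the end of the box. If
  the leading variable of the cube is not yet one of its directions, it is the least variable of all
  these remaining paths, and the first arrow of each sorted path gives the translated corner. A
  single push \<open>hp\<close> is not a contracting homotopy: \<open>1 - bd hp - hp bd\<close>
  replaces a cube by one whose far corner is nearer to the end, or by 0. Instead of summing
  iterates, boundaries are subtracted from a cycle until nothing is left; progress is measured by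
  the degree of the right factor \<open>q\<close>. The push changes \<open>S\<close> and
  \<open>q\<close> but not \<open>p\<close>, so it respects the left action only; this is harmless,
  since exactness concerns the underlying groups. Finiteness of the image of \<open>Phi\<close> is
  needed because the unit of the algebra is a sum over it. Its proof is where the lattice basis and
  the real kernel enter.\<close>

definition smul :: "'r::comm_ring_1 \<Rightarrow> ('k \<Rightarrow>\<^sub>0 'r) \<Rightarrow> ('k \<Rightarrow>\<^sub>0 'r)" where
  "smul c = Poly_Mapping.map ((*) c)"

lemma lookup_smul [simp]: "Poly_Mapping.lookup (smul c x) k = c * Poly_Mapping.lookup x k"
  by (simp add: smul_def map.rep_eq when_def)

lemma smul_add_right: "smul c (x + y) = smul c x + smul c y"
  by (rule poly_mapping_eqI) (simp add: lookup_add distrib_left)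

lemma smul_add_left: "smul (c + d) x = smul c x + smul d x"
  by (rule poly_mapping_eqI) (simp add: lookup_add distrib_right)

lemma smul_diff_right: "smul c (x - y) = smul c x - smul c y"
  by (rule poly_mapping_eqI) (simp add: lookup_minus right_diff_distrib)

lemma smul_minus_left: "smul (- c) x = - smul c x"
  by (rule poly_mapping_eqI) simp

lemma smul_smul [simp]: "smul c (smul d x) = smul (c * d) x"
  by (rule poly_mapping_eqI) (simp add: mult.assoc)

lemma smul_zero_left [simp]: "smul 0 x = 0"
  by (rule poly_mapping_eqI) simp

lemma smul_zero_right [simp]: "smul c 0 = 0"
  by (rule poly_mapping_eqI) simp

lemma smul_one [simp]: "smul 1 x = x"
  by (rule poly_mapping_eqI) simp

lemma smul_single [simp]: "smul c (Poly_Mapping.single k a) = Poly_Mapping.single k (c * a)"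
  by (rule poly_mapping_eqI) (simp add: lookup_single when_def)

lemma smul_sum: "smul c (sum f I) = (\<Sum>i\<in>I. smul c (f i))"
  by (induction I rule: infinite_finite_induct) (simp_all add: smul_add_right)

lemma keys_smul: "Poly_Mapping.keys (smul c x) \<subseteq> Poly_Mapping.keys x"
  by (auto simp: in_keys_iff)

text \<open>Maps are prescribed on basis elements and extended by \<open>lin\<close>; through
  \<open>lin_lin\<close>, an identity between composites reduces to one on single cells or
  morphisms.\<close>

definition lin :: "('k \<Rightarrow> ('l \<Rightarrow>\<^sub>0 'r::comm_ring_1)) \<Rightarrow> ('k \<Rightarrow>\<^sub>0 'r) \<Rightarrow> ('l \<Rightarrow>\<^sub>0 'r)" where
  "lin f x = (\<Sum>k\<in>Poly_Mapping.keys x. smul (Poly_Mapping.lookup x k) (f k))"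

lemma lin_zero [simp]: "lin f 0 = 0"
  by (simp add: lin_def)

lemma lin_single [simp]: "lin f (Poly_Mapping.single k c) = smul c (f k)"
  by (simp add: lin_def)

lemma lin_add: "lin f (x + y) = lin f x + lin f y"
  unfolding lin_def by (rule setsum_keys_plus_distrib) (simp_all add: smul_add_left)

lemma lin_uminus: "lin f (- x) = - lin f x"
proof -
  have "lin f (- x) + lin f x = 0"
    by (simp flip: lin_add)
  then show ?thesis
    by (simp add: eq_neg_iff_add_eq_0)
qed

lemma lin_diff: "lin f (x - y) = lin f x - lin f y"
  using lin_add[of f x "- y"] by (simp add: lin_uminus)

lemma lin_sum: "lin f (sum g I) = (\<Sum>i\<in>I. lin f (g i))"
  by (induction I rule: infinite_finite_induct) (simp_all add: lin_add)

lemma lin_cong: "(\<And>k. k \<in> Poly_Mapping.keys x \<Longrightarrow> f k = g k) \<Longrightarrow> lin f x = lin g x"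
  by (simp add: lin_def)

lemma lin_superset:
  assumes "finite K" "Poly_Mapping.keys x \<subseteq> K"
  shows "lin f x = (\<Sum>k\<in>K. smul (Poly_Mapping.lookup x k) (f k))"
  unfolding lin_def using assms by (intro sum.mono_neutral_left) (auto simp: in_keys_iff)

lemma lin_smul: "lin f (smul c x) = smul c (lin f x)"
proof -
  \<comment> \<open>Multiplication by \<open>c\<close> may annihilate coefficients and shrink the
    support, so the sum is first taken over the old support.\<close>
  have "lin f (smul c x) = (\<Sum>k\<in>Poly_Mapping.keys x. smul (c * Poly_Mapping.lookup x k) (f k))"
    by (subst lin_superset[of "Poly_Mapping.keys x"]) (auto simp: in_keys_iff)
  then show ?thesis
    by (simp add: lin_def smul_sum)
qed

lemma lin_lin: "lin f (lin g x) = lin (\<lambda>k. lin f (g k)) x"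
  by (simp add: lin_def[of g] lin_def[of "\<lambda>k. lin f (g k)"] lin_sum lin_smul)

lemma lin_zero_fun [simp]: "lin (\<lambda>k. 0) x = 0"
  by (simp add: lin_def)

lemma lin_add_fun: "lin (\<lambda>k. f k + g k) x = lin f x + lin g x"
  by (simp add: lin_def smul_add_right sum.distrib)

lemma lin_diff_fun: "lin (\<lambda>k. f k - g k) x = lin f x - lin g x"
  by (simp add: lin_def smul_diff_right sum_subtractf)

text \<open>Commutativity of the base ring makes both orders of bilinear extension agree. It brings
  right actions into the same nested form as left ones and lets the two actions commute.\<close>

lemma lin_swap: "lin (\<lambda>k. lin (\<lambda>l. f k l) y) x = lin (\<lambda>l. lin (\<lambda>k. f k l) x) y"
  by (simp add: lin_def smul_sum mult.commute) (rule sum.swap)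

lemma lin_id: "lin (\<lambda>k. Poly_Mapping.single k 1) x = x"
proof (rule poly_mapping_eqI)
  fix k
  show "Poly_Mapping.lookup (lin (\<lambda>k. Poly_Mapping.single k 1) x) k = Poly_Mapping.lookup x k"
    by (cases "k \<in> Poly_Mapping.keys x")
      (auto simp: lin_def lookup_sum lookup_single when_def in_keys_iff sum.delta)
qed

lemma keys_lin:
  assumes "k \<in> Poly_Mapping.keys (lin f x)"
  obtains l where "l \<in> Poly_Mapping.keys x" "k \<in> Poly_Mapping.keys (f l)"
proof -
  have "Poly_Mapping.keys (lin f x) \<subseteq> (\<Union>l\<in>Poly_Mapping.keys x. Poly_Mapping.keys (smul (Poly_Mapping.lookup x l) (f l)))"
    unfolding lin_def by (rule keys_sum)
  then obtain l where "l \<in> Poly_Mapping.keys x" "k \<in> Poly_Mapping.keys (smul (Poly_Mapping.lookup x l) (f l))"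
    using assms by auto
  then show ?thesis
    using that keys_smul[of _ "f l"] by (metis subsetD)
qed

lemma lin_eq_self:
  assumes "\<And>k. k \<in> Poly_Mapping.keys x \<Longrightarrow> f k = Poly_Mapping.single k 1"
  shows "lin f x = x"
  using lin_cong[of x f, OF assms] by (simp add: lin_id)

text \<open>An additive subgroup need not be stable under the base ring, hence the assumption on all
  multiples of \<open>f k\<close>.\<close>

lemma lin_mem_subgroup:
  assumes "additive_subgroup S" "\<And>k c. k \<in> Poly_Mapping.keys x \<Longrightarrow> smul c (f k) \<in> S"
  shows "lin f x \<in> S"
proof -
  have "(\<Sum>i\<in>I. smul (Poly_Mapping.lookup x i) (f i)) \<in> S" if "I \<subseteq> Poly_Mapping.keys x" for I
    using finite_subset[OF that finite_keys] that
    by (induction I rule: finite_induct) (use assms in \<open>auto simp: additive_subgroup_def\<close>)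
  then show ?thesis
    unfolding lin_def by blast
qed

section \<open>Free modules graded by a degree on the basis\<close>

lemma subgroup_keys: "additive_subgroup {x :: 'k \<Rightarrow>\<^sub>0 'r::comm_ring_1. Poly_Mapping.keys x \<subseteq> K}"
  unfolding additive_subgroup_def
proof (intro conjI ballI)
  fix x y :: "'k \<Rightarrow>\<^sub>0 'r"
  assume "x \<in> {x. Poly_Mapping.keys x \<subseteq> K}" "y \<in> {x. Poly_Mapping.keys x \<subseteq> K}"
  then show "x + y \<in> {x. Poly_Mapping.keys x \<subseteq> K}"
    using keys_add[of x y] by blast
qed (simp_all add: in_keys_iff subset_iff)

lemma is_grading_keys:
  fixes K :: "'k set" and deg :: "'k \<Rightarrow> nat"
  shows "is_grading {x :: 'k \<Rightarrow>\<^sub>0 'r::comm_ring_1. Poly_Mapping.keys x \<subseteq> K}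
    (\<lambda>d. {x. Poly_Mapping.keys x \<subseteq> {k \<in> K. deg k = d}})"
  unfolding is_grading_def
proof (intro conjI allI ballI)
  fix x :: "'k \<Rightarrow>\<^sub>0 'r"
  assume "x \<in> {x. Poly_Mapping.keys x \<subseteq> K}"
  then have xK: "Poly_Mapping.keys x \<subseteq> K" by simp
  define part where "part d = lin (\<lambda>k. if deg k = d then Poly_Mapping.single k 1 else 0) x" for d
  have lookup_part: "Poly_Mapping.lookup (part d) k = (if deg k = d then Poly_Mapping.lookup x k else 0)" for d k
  proof -
    have "Poly_Mapping.lookup (part d) k = (\<Sum>l\<in>Poly_Mapping.keys x. if l = k then (if deg k = d then Poly_Mapping.lookup x k else 0) else 0)"
      unfolding part_def lin_def lookup_sum by (rule sum.cong) (auto simp: lookup_single when_def)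
    then show ?thesis by (auto simp: in_keys_iff)
  qed
  have fin: "finite {d. part d \<noteq> 0}"
  proof (rule finite_subset)
    show "{d. part d \<noteq> 0} \<subseteq> deg ` Poly_Mapping.keys x"
    proof
      fix d assume "d \<in> {d. part d \<noteq> 0}"
      then obtain k where "Poly_Mapping.lookup (part d) k \<noteq> 0"
        by (metis lookup_zero mem_Collect_eq poly_mapping_eqI)
      then show "d \<in> deg ` Poly_Mapping.keys x"
        by (auto simp: lookup_part in_keys_iff split: if_splits)
    qed
  qed simp
  \<comment> \<open>In a sum of homogeneous pieces only the piece of degree \<open>deg k\<close>
    contributes to the coefficient at \<open>k\<close>. Existence and uniqueness both rest on
    this.\<close>
  have total: "Poly_Mapping.lookup (\<Sum>d\<in>Poly_Mapping.keys f. Poly_Mapping.lookup f d) k = Poly_Mapping.lookup (Poly_Mapping.lookup f (deg k)) k"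
    if "\<forall>d. Poly_Mapping.lookup f d \<in> {x. Poly_Mapping.keys x \<subseteq> {k \<in> K. deg k = d}}" for f :: "nat \<Rightarrow>\<^sub>0 'k \<Rightarrow>\<^sub>0 'r" and k
  proof -
    have "Poly_Mapping.lookup (Poly_Mapping.lookup f d) k = (if d = deg k then Poly_Mapping.lookup (Poly_Mapping.lookup f (deg k)) k else 0)" for d
      using that by (force simp: in_keys_iff)
    then have "(\<Sum>d\<in>Poly_Mapping.keys f. Poly_Mapping.lookup (Poly_Mapping.lookup f d) k) =
      (\<Sum>d\<in>Poly_Mapping.keys f. if d = deg k then Poly_Mapping.lookup (Poly_Mapping.lookup f (deg k)) k else 0)"
      by (intro sum.cong) auto
    then show ?thesis
      by (auto simp: lookup_sum in_keys_iff)
  qed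
  show "\<exists>!f. (\<forall>d. Poly_Mapping.lookup f d \<in> {x. Poly_Mapping.keys x \<subseteq> {k \<in> K. deg k = d}}) \<and>
    x = (\<Sum>d\<in>Poly_Mapping.keys f. Poly_Mapping.lookup f d)"
  proof (rule ex1I, intro conjI)
    have *: "Poly_Mapping.lookup (Abs_poly_mapping part) = part"
      using fin by simp
    show mem: "\<forall>d. Poly_Mapping.lookup (Abs_poly_mapping part) d \<in> {x. Poly_Mapping.keys x \<subseteq> {k \<in> K. deg k = d}}"
      unfolding * using xK by (auto simp: in_keys_iff lookup_part split: if_splits)
    show "x = (\<Sum>d\<in>Poly_Mapping.keys (Abs_poly_mapping part). Poly_Mapping.lookup (Abs_poly_mapping part) d)"
      by (rule poly_mapping_eqI) (subst total[OF mem], simp add: * lookup_part)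
  next
    fix f :: "nat \<Rightarrow>\<^sub>0 'k \<Rightarrow>\<^sub>0 'r"
    assume f: "(\<forall>d. Poly_Mapping.lookup f d \<in> {x. Poly_Mapping.keys x \<subseteq> {k \<in> K. deg k = d}}) \<and>
      x = (\<Sum>d\<in>Poly_Mapping.keys f. Poly_Mapping.lookup f d)"
    have "Poly_Mapping.lookup (Poly_Mapping.lookup f d) k = Poly_Mapping.lookup (part d) k" for d k
    proof (cases "d = deg k")
      case True
      then show ?thesis
        using total[of f k] f by (simp add: lookup_part)
    next
      case False
      then have "k \<notin> Poly_Mapping.keys (Poly_Mapping.lookup f d)"
        using f by blast
      then show ?thesis
        using False by (simp add: lookup_part in_keys_iff)
    qed
    then show "f = Abs_poly_mapping part"
      using fin by (auto intro!: poly_mapping_eqI)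
  qed
next
  fix d
  show "additive_subgroup {x :: 'k \<Rightarrow>\<^sub>0 'r. Poly_Mapping.keys x \<subseteq> {k \<in> K. deg k = d}}"
    by (rule subgroup_keys)
next
  fix d
  show "{x :: 'k \<Rightarrow>\<^sub>0 'r. Poly_Mapping.keys x \<subseteq> {k \<in> K. deg k = d}} \<subseteq> {x. Poly_Mapping.keys x \<subseteq> K}"
    by blast
qed

text \<open>The descent replaces a contracting homotopy: it suffices to lower the leading term of a cycle
  by a boundary.\<close>

lemma boundary_by_descent:
  fixes Z :: "('k \<Rightarrow>\<^sub>0 'r::comm_ring_1) set" and deg :: "'k \<Rightarrow> nat"
  assumes B: "additive_subgroup B"
    and step: "\<And>x. x \<in> Z \<Longrightarrow> \<exists>y\<in>B. x - y \<in> Z \<and>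
      (\<forall>k\<in>Poly_Mapping.keys (x - y). \<exists>k'\<in>Poly_Mapping.keys x. deg k < deg k')"
    and "x \<in> Z"
  shows "x \<in> B"
proof -
  have "x \<in> B" if "x \<in> Z" "\<forall>k\<in>Poly_Mapping.keys x. deg k < n" for x n
    using that
  proof (induction n arbitrary: x)
    case 0
    then have "x = 0" by (simp flip: keys_eq_empty)
    then show ?case using B by (simp add: additive_subgroup_def)
  next
    case (Suc n)
    obtain y where y: "y \<in> B" "x - y \<in> Z"
        "\<And>k. k \<in> Poly_Mapping.keys (x - y) \<Longrightarrow> \<exists>k'\<in>Poly_Mapping.keys x. deg k < deg k'"
      using step[OF Suc.prems(1)] by blast
    then have "\<forall>k\<in>Poly_Mapping.keys (x - y). deg k < n"
      using Suc.prems(2) by fastforce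
    then have "x - y \<in> B"
      using Suc.IH y by blast
    then have "(x - y) + y \<in> B"
      using B y(1) unfolding additive_subgroup_def by blast
    then show ?case by simp
  qed
  moreover have "\<forall>k\<in>Poly_Mapping.keys x. deg k < Suc (Max (deg ` Poly_Mapping.keys x))"
    by (auto simp: less_Suc_eq_le)
  ultimately show ?thesis
    using assms(3) by blast
qed


section \<open>Degrees, squarefree exponents and signs\<close>

definition total_degree :: "(nat \<Rightarrow>\<^sub>0 nat) \<Rightarrow> nat" where
  "total_degree u = (\<Sum>i\<in>Poly_Mapping.keys u. Poly_Mapping.lookup u i)"

lemma total_degree_add: "total_degree (u + v) = total_degree u + total_degree v"
  unfolding total_degree_def by (rule setsum_keys_plus_distrib) simp_all

lemma total_degree_zero [simp]: "total_degree 0 = 0"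
  by (simp add: total_degree_def)

lemma total_degree_single [simp]: "total_degree (Poly_Mapping.single i c) = c"
  by (simp add: total_degree_def)

definition var :: "nat \<Rightarrow> (nat \<Rightarrow>\<^sub>0 nat)" where
  "var i = Poly_Mapping.single i 1"

lemma lookup_var: "Poly_Mapping.lookup (var i) j = (1 when j = i)"
  by (simp add: var_def lookup_single when_def)

lemma keys_var [simp]: "Poly_Mapping.keys (var i) = {i}"
  by (simp add: var_def)

lemma total_degree_var [simp]: "total_degree (var i) = 1"
  by (simp add: var_def)

text \<open>The exponent of the product of the variables in \<open>S\<close>: the displacement from
  the least corner of a cube to the corner reached through the directions in
  \<open>S\<close>.\<close>

definition squarefree_expo :: "nat set \<Rightarrow> (nat \<Rightarrow>\<^sub>0 nat)" where
  "squarefree_expo S = (\<Sum>i\<in>S. var i)"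

lemma squarefree_expo_empty [simp]: "squarefree_expo {} = 0"
  by (simp add: squarefree_expo_def)

lemma squarefree_expo_remove:
  "finite S \<Longrightarrow> i \<in> S \<Longrightarrow> squarefree_expo S = var i + squarefree_expo (S - {i})"
  by (simp add: squarefree_expo_def sum.remove)

lemma keys_squarefree_expo [simp]: "finite S \<Longrightarrow> Poly_Mapping.keys (squarefree_expo S) = S"
  by (auto simp: squarefree_expo_def in_keys_iff lookup_sum lookup_var when_def split: if_splits)

lemma keys_add_nat: "Poly_Mapping.keys (u + v :: 'a \<Rightarrow>\<^sub>0 nat) = Poly_Mapping.keys u \<union> Poly_Mapping.keys v"
  by (auto simp: in_keys_iff lookup_add)

lemma var_plus_minus:
  fixes u :: "nat \<Rightarrow>\<^sub>0 nat"
  shows "i \<in> Poly_Mapping.keys u \<Longrightarrow> var i + (u - var i) = u"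
  by (rule poly_mapping_eqI) (auto simp: lookup_add lookup_minus lookup_var when_def in_keys_iff)

text \<open>The induction splits off all pairs containing the new element, so that no division by
  two is needed and every characteristic is covered.\<close>

lemma sum_antisymmetric:
  fixes f :: "'i \<Rightarrow> 'i \<Rightarrow> 'm::ab_group_add"
  assumes "finite S" "\<And>i j. i \<in> S \<Longrightarrow> j \<in> S \<Longrightarrow> i \<noteq> j \<Longrightarrow> f i j + f j i = 0"
  shows "(\<Sum>i\<in>S. \<Sum>j\<in>S - {i}. f i j) = 0"
  using assms
proof (induction S rule: finite_induct)
  case (insert a S)
  have "(\<Sum>j\<in>insert a S - {i}. f i j) = f i a + (\<Sum>j\<in>S - {i}. f i j)" if "i \<in> S" for i
  proof -
    have "insert a S - {i} = insert a (S - {i})" "a \<notin> S - {i}"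
      using that insert.hyps by auto
    then show ?thesis using insert.hyps by simp
  qed
  then have "(\<Sum>i\<in>S. \<Sum>j\<in>insert a S - {i}. f i j) = (\<Sum>i\<in>S. f i a)"
    using insert by (simp add: sum.distrib)
  moreover have "insert a S - {a} = S"
    using insert.hyps by auto
  ultimately have "(\<Sum>i\<in>insert a S. \<Sum>j\<in>insert a S - {i}. f i j) = (\<Sum>i\<in>S. f a i + f i a)"
    using insert.hyps by (simp add: sum.distrib)
  also have "\<dots> = 0"
    using insert.hyps by (intro sum.neutral ballI insert.prems) auto
  finally show ?case .
qed simp

text \<open>Directions are ordered by \<open>s\<close> and not numerically, so that the leading
  direction carries the sign 1 and its insertion flips all other signs.\<close>

definition koszul_sign :: "(nat \<Rightarrow> nat) \<Rightarrow> nat set \<Rightarrow> nat \<Rightarrow> 'r::comm_ring_1" where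
  "koszul_sign s S l = (- 1) ^ card {i \<in> S. s i < s l}"

lemma koszul_sign_remove_less:
  assumes "finite S" "i \<in> S" "s i < s l"
  shows "koszul_sign s (S - {i}) l = - koszul_sign s S l"
proof -
  have "{a \<in> S. s a < s l} = insert i {a \<in> S - {i}. s a < s l}"
    using assms by auto
  then show ?thesis
    using assms(1) by (simp add: koszul_sign_def)
qed

lemma koszul_sign_remove_not_less:
  assumes "\<not> s i < s l"
  shows "koszul_sign s (S - {i}) l = koszul_sign s S l"
proof -
  have "{a \<in> S - {i}. s a < s l} = {a \<in> S. s a < s l}"
    using assms by auto
  then show ?thesis
    by (simp add: koszul_sign_def)
qed

lemma koszul_sign_least:
  assumes "\<And>i. i \<in> S \<Longrightarrow> s l \<le> s i"
  shows "koszul_sign s S l = 1"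
proof -
  have "{i \<in> S. s i < s l} = {}"
    using assms by force
  then show ?thesis
    by (simp only: koszul_sign_def card.empty power_0)
qed

text \<open>One of the two directions precedes the other. Removing the earlier one flips the sign of
  the later one; removing the later one changes nothing.\<close>

lemma koszul_sign_antisymmetric:
  assumes "inj s" "finite S" "i \<in> S" "j \<in> S" "i \<noteq> j"
  shows "koszul_sign s S i * koszul_sign s (S - {i}) j + koszul_sign s S j * koszul_sign s (S - {j}) i = 0"
proof -
  have "s i < s j \<or> s j < s i"
    using assms(1,5) by (metis injD linorder_neqE)
  then show ?thesis
    using assms by (auto simp: koszul_sign_remove_less koszul_sign_remove_not_less mult.commute)
qed


section \<open>The cubical bimodule complex\<close>

text \<open>The middle number codes a finite set of directions through \<open>set_decode\<close>,
  which places the chains in the type of the free bimodules.\<close>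

type_synonym 'g cell = "'g mono_mor \<times> nat \<times> 'g mono_mor"

lemma mor_simps [simp]:
  "src (v, u, w) = v" "expo (v, u, w) = u" "tgt (v, u, w) = w"
  "src (concat_mor p q) = src p" "expo (concat_mor p q) = expo p + expo q"
  "tgt (concat_mor p q) = tgt q"
  by (simp_all add: src_def expo_def tgt_def concat_mor_def)

lemma mor_eqI: "src p = src q \<Longrightarrow> expo p = expo q \<Longrightarrow> tgt p = tgt q \<Longrightarrow> p = q"
  by (auto simp: src_def expo_def tgt_def prod_eq_iff)

lemma concat_mor_assoc: "concat_mor (concat_mor p q) r = concat_mor p (concat_mor q r)"
  by (rule mor_eqI) (simp_all add: add.assoc)

section \<open>Actions and products on basis elements\<close>

definition lact_basis :: "'g mono_mor \<Rightarrow> 'g cell \<Rightarrow> ('g cell \<Rightarrow>\<^sub>0 'r::comm_ring_1)" where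
  "lact_basis r = (\<lambda>(p, j, q). if tgt r = src p then Poly_Mapping.single (concat_mor r p, j, q) 1 else 0)"

definition ract_basis :: "'g mono_mor \<Rightarrow> 'g cell \<Rightarrow> ('g cell \<Rightarrow>\<^sub>0 'r::comm_ring_1)" where
  "ract_basis r = (\<lambda>(p, j, q). if tgt q = src r then Poly_Mapping.single (p, j, concat_mor q r) 1 else 0)"

definition mult_basis :: "'g mono_mor \<Rightarrow> 'g mono_mor \<Rightarrow> ('g mono_mor \<Rightarrow>\<^sub>0 'r::comm_ring_1)" where
  "mult_basis p q = (if tgt p = src q then Poly_Mapping.single (concat_mor p q) 1 else 0)"

lemma lact_basis_simps [simp]:
  "lact_basis r (p, j, q) = (if tgt r = src p then Poly_Mapping.single (concat_mor r p, j, q) 1 else 0)"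
  by (simp add: lact_basis_def)

lemma ract_basis_simps [simp]:
  "ract_basis r (p, j, q) = (if tgt q = src r then Poly_Mapping.single (p, j, concat_mor q r) 1 else 0)"
  by (simp add: ract_basis_def)

lemma lact_free_bimod:
  "lact (free_bimod N mu J deg) f x = lin (\<lambda>r. lin (lact_basis r) x) f"
  by (auto simp: free_bimod_def lin_def smul_sum intro!: sum.cong)

lemma ract_free_bimod:
  "ract (free_bimod N mu J deg) x f = lin (\<lambda>r. lin (ract_basis r) x) f"
proof -
  have "lin (\<lambda>k. lin (\<lambda>r. ract_basis r k) f) x = ract (free_bimod N mu J deg) x f"
    by (auto simp: free_bimod_def lin_def smul_sum intro!: sum.cong)
  then show ?thesis
    by (simp add: lin_swap[of _ f])
qed

lemma amult_bondal_ruan: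
  "amult (bondal_ruan_algebra N mu) f g = lin (\<lambda>p. lin (mult_basis p) g) f"
  by (auto simp: bondal_ruan_algebra_def lin_def smul_sum mult_basis_def intro!: sum.cong)

text \<open>What exactness and the bimodule structure need from the stack and from directability.
  Sorted paths enter only through \<open>first_step\<close>, which speaks of the first arrow;
  \<open>path_length_eq\<close> makes degrees computable from exponents.\<close>

locale directed_monomials =
  fixes N :: nat and mu :: "(nat \<Rightarrow>\<^sub>0 int) \<Rightarrow> 'g::ab_group_add" and s :: "nat \<Rightarrow> nat"
  assumes mu_add: "u \<in> vecs N \<Longrightarrow> v \<in> vecs N \<Longrightarrow> mu (u + v) = mu u + mu v"
    and finite_im_Phi: "finite (im_Phi N mu)"
    and inj_s: "inj s"
    and path_length_eq: "p \<in> mono_mors N mu \<Longrightarrow> path_length N mu p = total_degree (expo p)"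
    and first_step: "p \<in> mono_mors N mu \<Longrightarrow> i \<in> Poly_Mapping.keys (expo p) \<Longrightarrow>
      (\<And>j. j \<in> Poly_Mapping.keys (expo p) \<Longrightarrow> s i \<le> s j) \<Longrightarrow>
      src p - mu (Poly_Mapping.single i 1) \<in> im_Phi N mu"
begin

definition wt :: "(nat \<Rightarrow>\<^sub>0 nat) \<Rightarrow> 'g" where
  "wt u = mu (Poly_Mapping.map int u)"

lemma map_int_add: "Poly_Mapping.map int (u + v) = Poly_Mapping.map int u + Poly_Mapping.map int v"
  by (rule poly_mapping_eqI) (simp add: map.rep_eq lookup_add when_def)

lemma keys_map_int [simp]: "Poly_Mapping.keys (Poly_Mapping.map int u) = Poly_Mapping.keys u"
  by (auto simp: in_keys_iff map.rep_eq when_def split: if_splits)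

lemma map_int_mem_vecs [simp]: "Poly_Mapping.map int u \<in> vecs N \<longleftrightarrow> u \<in> vecs N"
  by (simp add: vecs_def)

lemma wt_add: "u \<in> vecs N \<Longrightarrow> v \<in> vecs N \<Longrightarrow> wt (u + v) = wt u + wt v"
  by (simp add: wt_def map_int_add mu_add)

lemma wt_zero [simp]: "wt 0 = 0"
  using wt_add[of 0 0] by (simp add: vecs_def)

lemma wt_var: "wt (var i) = mu (Poly_Mapping.single i 1)"
  by (simp add: wt_def var_def)

lemma add_mem_vecs [simp]: "u + v \<in> vecs N \<longleftrightarrow> u \<in> vecs N \<and> v \<in> vecs N" for u v :: "nat \<Rightarrow>\<^sub>0 nat"
  by (simp add: vecs_def keys_add_nat)

lemma var_mem_vecs [simp]: "var i \<in> vecs N \<longleftrightarrow> i < N"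
  by (simp add: vecs_def)

lemma zero_mem_vecs [simp]: "(0 :: nat \<Rightarrow>\<^sub>0 nat) \<in> vecs N"
  by (simp add: vecs_def)

lemma squarefree_expo_mem_vecs [simp]: "finite S \<Longrightarrow> squarefree_expo S \<in> vecs N \<longleftrightarrow> S \<subseteq> {..<N}"
  by (simp add: vecs_def)

abbreviation "V \<equiv> im_Phi N mu"
abbreviation "M \<equiv> mono_mors N mu"
abbreviation x_wt :: "nat \<Rightarrow> 'g" where "x_wt l \<equiv> wt (var l)"

lemma mem_M: "p \<in> M \<longleftrightarrow> src p \<in> V \<and> tgt p \<in> V \<and> expo p \<in> vecs N \<and> wt (expo p) = src p - tgt p"
  by (cases p) (auto simp: mono_mors_def wt_def)

lemma concat_mem_M: "p \<in> M \<Longrightarrow> q \<in> M \<Longrightarrow> tgt p = src q \<Longrightarrow> concat_mor p q \<in> M"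
  by (simp add: mem_M wt_add)

lemma path_length_concat:
  "p \<in> M \<Longrightarrow> q \<in> M \<Longrightarrow> tgt p = src q \<Longrightarrow>
    path_length N mu (concat_mor p q) = path_length N mu p + path_length N mu q"
  by (simp add: path_length_eq concat_mem_M total_degree_add)

section \<open>Moving a variable between the two tensor factors\<close>

definition append_var :: "nat \<Rightarrow> 'g mono_mor \<Rightarrow> 'g mono_mor" where
  "append_var l p = (src p, expo p + var l, tgt p - x_wt l)"

definition prepend_var :: "nat \<Rightarrow> 'g mono_mor \<Rightarrow> 'g mono_mor" where
  "prepend_var l q = (src q + x_wt l, var l + expo q, tgt q)"

text \<open>Subtraction of exponents is truncated, so a variable can be taken off and put back only
  if it occurs in the exponent.\<close>

definition cancel_var :: "nat \<Rightarrow> 'g mono_mor \<Rightarrow> 'g mono_mor" where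
  "cancel_var l q = (src q - x_wt l, expo q - var l, tgt q)"

lemma var_simps [simp]:
  "src (append_var l p) = src p" "expo (append_var l p) = expo p + var l"
  "tgt (append_var l p) = tgt p - x_wt l"
  "src (prepend_var l q) = src q + x_wt l" "expo (prepend_var l q) = var l + expo q"
  "tgt (prepend_var l q) = tgt q"
  "src (cancel_var l q) = src q - x_wt l" "expo (cancel_var l q) = expo q - var l"
  "tgt (cancel_var l q) = tgt q"
  by (simp_all add: append_var_def prepend_var_def cancel_var_def)

lemma append_var_mem_M:
  "p \<in> M \<Longrightarrow> l < N \<Longrightarrow> tgt p - x_wt l \<in> V \<Longrightarrow> append_var l p \<in> M"
  by (simp add: mem_M wt_add)

lemma prepend_var_mem_M:
  "q \<in> M \<Longrightarrow> l < N \<Longrightarrow> src q + x_wt l \<in> V \<Longrightarrow> prepend_var l q \<in> M"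
  by (simp add: mem_M wt_add)

lemma cancel_var_mem_M:
  assumes "q \<in> M" "l \<in> Poly_Mapping.keys (expo q)" "src q - x_wt l \<in> V"
  shows "cancel_var l q \<in> M"
proof -
  let ?u = "expo q - var l"
  have eq: "expo q = var l + ?u"
    using var_plus_minus[OF assms(2)] by simp
  have "var l + ?u \<in> vecs N"
    using assms(1) eq by (metis mem_M)
  then have l: "var l \<in> vecs N" "?u \<in> vecs N"
    by (simp_all only: add_mem_vecs)
  have "wt (expo q) = x_wt l + wt ?u"
    by (subst eq) (rule wt_add[OF l])
  then show ?thesis
    using assms l by (simp add: mem_M algebra_simps)
qed

lemma append_var_commute: "append_var l (append_var l' p) = append_var l' (append_var l p)"
  by (rule mor_eqI) (simp_all add: algebra_simps)

lemma prepend_var_commute: "prepend_var l (prepend_var l' p) = prepend_var l' (prepend_var l p)"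
  by (rule mor_eqI) (simp_all add: algebra_simps)

lemma cancel_prepend_var [simp]: "cancel_var l (prepend_var l q) = q"
  by (rule mor_eqI) simp_all

lemma prepend_cancel_var [simp]: "l \<in> Poly_Mapping.keys (expo q) \<Longrightarrow> prepend_var l (cancel_var l q) = q"
  using var_plus_minus[of l "expo q"] by (intro mor_eqI) simp_all

lemma cancel_prepend_var_commute:
  assumes "l \<in> Poly_Mapping.keys (expo q)"
  shows "cancel_var l (prepend_var l' q) = prepend_var l' (cancel_var l q)"
proof (rule mor_eqI)
  show "expo (cancel_var l (prepend_var l' q)) = expo (prepend_var l' (cancel_var l q))"
    using assms by (intro poly_mapping_eqI)
      (auto simp: lookup_add lookup_minus lookup_var when_def in_keys_iff)
qed simp_all

lemma concat_append_var: "concat_mor r (append_var l p) = append_var l (concat_mor r p)"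
  by (rule mor_eqI) (simp_all add: algebra_simps)

lemma concat_prepend_var: "concat_mor (prepend_var l p) r = prepend_var l (concat_mor p r)"
  by (rule mor_eqI) (simp_all add: algebra_simps)

text \<open>The ends \<open>p x_l \<otimes> q\<close> and \<open>p \<otimes> x_l q\<close> of an
  edge have the same product, which is why the augmentation vanishes on boundaries.\<close>

lemma concat_append_prepend_var: "concat_mor (append_var l p) q = concat_mor p (prepend_var l q)"
  by (rule mor_eqI) (simp_all add: algebra_simps)

text \<open>Given a start vertex and a total exponent \<open>u\<close>, the cell \<open>(p, j, q)\<close> is the cube with least
  corner \<open>expo p\<close> and directions \<open>set_decode j\<close> in the box \<open>[0, u]\<close>, all of whose corners stay in
  \<open>V\<close>. It spans the summand \<open>p \<otimes> q\<close> on the generator \<open>(tgt p, set_decode j)\<close>.\<close>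

definition cells :: "nat \<Rightarrow> 'g cell set" where
  "cells i = {(p, j, q). p \<in> M \<and> q \<in> M \<and> set_decode j \<subseteq> {..<N} \<and> card (set_decode j) = i \<and>
     src q = tgt p - wt (squarefree_expo (set_decode j)) \<and>
     (\<forall>T \<subseteq> set_decode j. tgt p - wt (squarefree_expo T) \<in> V)}"

lemma mem_cells: "finite S \<Longrightarrow> (p, set_encode S, q) \<in> cells i \<longleftrightarrow> p \<in> M \<and> q \<in> M \<and> S \<subseteq> {..<N} \<and>
    card S = i \<and> src q = tgt p - wt (squarefree_expo S) \<and>
    (\<forall>T \<subseteq> S. tgt p - wt (squarefree_expo T) \<in> V)"
  by (simp add: cells_def)

text \<open>Every natural number codes exactly one finite set, so arguments on cells can be carried
  out with a set \<open>S\<close> in place of its code.\<close>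

lemma cell_cases:
  obtains p S q where "k = (p, set_encode S, q)" "finite S"
  by (metis finite_set_decode prod_cases3 set_decode_inverse)

lemma wt_squarefree_remove:
  assumes "finite S" "S \<subseteq> {..<N}" "l \<in> S"
  shows "wt (squarefree_expo S) = x_wt l + wt (squarefree_expo (S - {l}))"
  using assms by (subst squarefree_expo_remove[of S l]) (auto intro!: wt_add)

text \<open>These are the near and the far face in direction \<open>l\<close>. Corner
  \<open>T\<close> of the far face is corner \<open>insert l T\<close> of the cube, so both inherit
  the condition on corners.\<close>

lemma cell_remove:
  assumes "finite S" "l \<in> S" "(p, set_encode S, q) \<in> cells (Suc i)"
  shows "(p, set_encode (S - {l}), prepend_var l q) \<in> cells i"
    and "(append_var l p, set_encode (S - {l}), q) \<in> cells i"
proof -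
  have *: "p \<in> M" "q \<in> M" "S \<subseteq> {..<N}" "card S = Suc i" "src q = tgt p - wt (squarefree_expo S)"
      and V: "\<And>T. T \<subseteq> S \<Longrightarrow> tgt p - wt (squarefree_expo T) \<in> V"
    using assms by (auto simp: mem_cells)
  have l: "l < N"
    using * assms by auto
  note wS = wt_squarefree_remove[OF assms(1) *(3) assms(2)]
  have "src q + x_wt l \<in> V"
    using V[of "S - {l}"] by (simp add: *(5) wS)
  then have "prepend_var l q \<in> M"
    using * l by (simp add: prepend_var_mem_M)
  then show "(p, set_encode (S - {l}), prepend_var l q) \<in> cells i"
    using * V assms wS by (auto simp: mem_cells)
  have "tgt p - x_wt l \<in> V"
    using V[of "{l}"] assms by (simp add: squarefree_expo_def)
  then have "append_var l p \<in> M"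
    using * l by (simp add: append_var_mem_M)
  moreover have "tgt p - x_wt l - wt (squarefree_expo T) \<in> V" if "T \<subseteq> S - {l}" for T
  proof -
    have T: "finite (insert l T)" "insert l T \<subseteq> S" "insert l T - {l} = T"
      using that assms by (auto intro: finite_subset)
    have "wt (squarefree_expo (insert l T)) = x_wt l + wt (squarefree_expo T)"
      using wt_squarefree_remove[of "insert l T" l] T *(3) by auto
    then show ?thesis
      using V[OF T(2)] by (simp add: algebra_simps)
  qed
  ultimately show "(append_var l p, set_encode (S - {l}), q) \<in> cells i"
    using * assms wS by (auto simp: mem_cells algebra_simps)
qed

text \<open>The variables in \<open>S\<close> and in \<open>q\<close> are those still separating the
  least corner of the cube from the end of the box. If there are none, the value is arbitrary, which
  explains the guard in \<open>hp\<close>.\<close>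

definition lead :: "nat set \<Rightarrow> 'g mono_mor \<Rightarrow> nat" where
  "lead S q = arg_min_on s (S \<union> Poly_Mapping.keys (expo q))"

lemma lead_eqI:
  assumes "finite S" "m \<in> S \<union> Poly_Mapping.keys (expo q)"
    and "\<And>i. i \<in> S \<union> Poly_Mapping.keys (expo q) \<Longrightarrow> s m \<le> s i"
  shows "lead S q = m"
proof -
  let ?X = "S \<union> Poly_Mapping.keys (expo q)"
  have X: "finite ?X" "?X \<noteq> {}"
    using assms by auto
  have "s (lead S q) \<le> s m"
    unfolding lead_def using X assms(2) by (rule arg_min_least)
  moreover have "s m \<le> s (lead S q)"
    unfolding lead_def by (rule assms(3)) (rule arg_min_if_finite(1)[OF X])
  ultimately show ?thesis
    using inj_s by (metis injD order_antisym)
qed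

lemma lead:
  assumes "finite S" "S \<union> Poly_Mapping.keys (expo q) \<noteq> {}"
  shows "lead S q \<in> S \<union> Poly_Mapping.keys (expo q)"
    and "i \<in> S \<union> Poly_Mapping.keys (expo q) \<Longrightarrow> s (lead S q) \<le> s i"
  unfolding lead_def using assms
  by (simp_all only: arg_min_if_finite(1) arg_min_least finite_Un finite_keys simp_thms)

text \<open>Sorted paths keep \<open>V\<close> stable under moving each corner of the cube one step in the leading
  direction towards the end of the box.\<close>

lemma cell_insert:
  assumes S: "finite S" and cell: "(p, set_encode S, q) \<in> cells i"
    and ne: "S \<union> Poly_Mapping.keys (expo q) \<noteq> {}" and m: "lead S q \<notin> S"
  shows "(p, set_encode (insert (lead S q) S), cancel_var (lead S q) q) \<in> cells (Suc i)"
proof -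
  define m where "m = lead S q"
  have *: "p \<in> M" "q \<in> M" "S \<subseteq> {..<N}" "card S = i" "src q = tgt p - wt (squarefree_expo S)"
      and V: "\<And>T. T \<subseteq> S \<Longrightarrow> tgt p - wt (squarefree_expo T) \<in> V"
    using cell S by (auto simp: mem_cells)
  have mq: "m \<in> Poly_Mapping.keys (expo q)" and mS: "m \<notin> S"
    using lead(1)[OF S ne] m by (auto simp: m_def)
  have mN: "m < N"
    using mq *(2) by (auto simp: mem_M vecs_def)
  have step: "tgt p - wt (squarefree_expo T) - x_wt m \<in> V" if T: "T \<subseteq> S" for T
  proof -
    have fin: "finite T" "finite (S - T)" and ST: "S - T \<subseteq> {..<N}" "T \<subseteq> {..<N}"
      using T S *(3) by (auto intro: finite_subset)
    have "squarefree_expo S = squarefree_expo T + squarefree_expo (S - T)"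
      using sum.subset_diff[OF T S] by (simp add: squarefree_expo_def add.commute)
    then have wS: "wt (squarefree_expo S) = wt (squarefree_expo T) + wt (squarefree_expo (S - T))"
      using fin ST by (simp add: wt_add)
    \<comment> \<open>The morphism from corner \<open>T\<close> to the end of the box. Its variables
      are those of \<open>S - T\<close> and of \<open>q\<close>, among which \<open>m\<close> occurs
      and is least, so \<open>first_step\<close> applies at this corner.\<close>
    let ?r = "(tgt p - wt (squarefree_expo T), squarefree_expo (S - T) + expo q, tgt q)"
    have "?r \<in> M"
      using * V[OF T] wS fin ST by (auto simp: mem_M wt_add)
    moreover have "m \<in> Poly_Mapping.keys (expo ?r)"
      using mq by (simp add: keys_add_nat)
    moreover have "s m \<le> s j" if "j \<in> Poly_Mapping.keys (expo ?r)" for j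
      using that fin lead(2)[OF S ne, of j] by (auto simp: keys_add_nat m_def)
    ultimately have "src ?r - mu (Poly_Mapping.single m 1) \<in> V"
      by (rule first_step)
    then show ?thesis
      by (simp add: wt_var[symmetric])
  qed
  \<comment> \<open>A corner that involves \<open>m\<close> is the translate by \<open>m\<close> of
    the corner \<open>T - {m}\<close> of the old cube.\<close>
  have cube: "tgt p - wt (squarefree_expo T) \<in> V" if T: "T \<subseteq> insert m S" for T
  proof (cases "m \<in> T")
    case True
    have T': "T - {m} \<subseteq> S" "finite T" "T \<subseteq> {..<N}"
      using T S * mN by (auto intro: finite_subset)
    show ?thesis
      using step[OF T'(1)] wt_squarefree_remove[OF T'(2,3) True] by (simp add: algebra_simps)
  qed (use T V in auto)
  have wS: "wt (squarefree_expo (insert m S)) = x_wt m + wt (squarefree_expo S)"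
    using wt_squarefree_remove[of "insert m S" m] S mS mN * by auto
  have "cancel_var m q \<in> M"
    using step[of S] * mq by (auto intro!: cancel_var_mem_M)
  then have "(p, set_encode (insert m S), cancel_var m q) \<in> cells (Suc i)"
    using * S mS mN wS cube
    unfolding mem_cells[OF finite.insertI[OF S]] by (auto simp: algebra_simps)
  then show ?thesis
    by (simp add: m_def)
qed

section \<open>The boundary and the push\<close>

definition face :: "nat set \<Rightarrow> 'g mono_mor \<Rightarrow> 'g mono_mor \<Rightarrow> nat \<Rightarrow> ('g cell \<Rightarrow>\<^sub>0 'r::comm_ring_1)" where
  "face S p q l = Poly_Mapping.single (p, set_encode (S - {l}), prepend_var l q) 1
     - Poly_Mapping.single (append_var l p, set_encode (S - {l}), q) 1"

text \<open>The differential of the Koszul bimodule complex of the polynomial ring: signed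
  differences of the near face \<open>p \<otimes> x_l q\<close> and the far face
  \<open>p x_l \<otimes> q\<close>.\<close>

definition bd :: "'g cell \<Rightarrow> ('g cell \<Rightarrow>\<^sub>0 'r::comm_ring_1)" where
  "bd = (\<lambda>(p, j, q). \<Sum>l\<in>set_decode j. smul (koszul_sign s (set_decode j) l) (face (set_decode j) p q l))"

text \<open>One push in the leading direction. A cell already extended in that direction goes to 0,
  as it is itself the push of its near face in this direction.\<close>

definition hp :: "'g cell \<Rightarrow> ('g cell \<Rightarrow>\<^sub>0 'r::comm_ring_1)" where
  "hp = (\<lambda>(p, j, q). let S = set_decode j; m = lead S q in
     if S \<union> Poly_Mapping.keys (expo q) = {} \<or> m \<in> S then 0
     else Poly_Mapping.single (p, set_encode (insert m S), cancel_var m q) 1)"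

lemma bd_encode:
  "finite S \<Longrightarrow> bd (p, set_encode S, q) = (\<Sum>l\<in>S. smul (koszul_sign s S l) (face S p q l))"
  by (simp add: bd_def)

lemma hp_encode:
  "finite S \<Longrightarrow> hp (p, set_encode S, q) = (if S \<union> Poly_Mapping.keys (expo q) = {} \<or> lead S q \<in> S then 0
     else Poly_Mapping.single (p, set_encode (insert (lead S q) S), cancel_var (lead S q) q) 1)"
  by (simp add: hp_def Let_def)

lemma keys_bd:
  assumes "k \<in> cells (Suc i)"
  shows "Poly_Mapping.keys (bd k :: _ \<Rightarrow>\<^sub>0 'r::comm_ring_1) \<subseteq> cells i"
proof -
  obtain p S q where k: "k = (p, set_encode S, q)" and S: "finite S"
    by (rule cell_cases)
  have "Poly_Mapping.keys (smul c (face S p q l) :: _ \<Rightarrow>\<^sub>0 'r) \<subseteq> cells i" if "l \<in> S" for c l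
  proof -
    have "Poly_Mapping.keys (smul c (face S p q l) :: _ \<Rightarrow>\<^sub>0 'r) \<subseteq> Poly_Mapping.keys (face S p q l :: _ \<Rightarrow>\<^sub>0 'r)"
      by (rule keys_smul)
    also have "\<dots> \<subseteq> {(p, set_encode (S - {l}), prepend_var l q), (append_var l p, set_encode (S - {l}), q)}"
      unfolding face_def by (rule order_trans[OF keys_diff]) auto
    also have "\<dots> \<subseteq> cells i"
      using cell_remove[OF S that] assms k by simp
    finally show ?thesis .
  qed
  then show ?thesis
    unfolding k bd_encode[OF S] by (intro order_trans[OF keys_sum]) auto
qed

lemma keys_hp:
  assumes "k \<in> cells i"
  shows "Poly_Mapping.keys (hp k :: _ \<Rightarrow>\<^sub>0 'r::comm_ring_1) \<subseteq> cells (Suc i)"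
proof -
  obtain p S q where k: "k = (p, set_encode S, q)" and S: "finite S"
    by (rule cell_cases)
  show ?thesis
    using cell_insert[OF S] assms unfolding k hp_encode[OF S] by auto
qed

text \<open>The second difference \<open>W l l'\<close> is symmetric in the two directions, whereas
  the product of the signs is antisymmetric.\<close>

lemma bd_bd: "lin bd (bd k :: _ \<Rightarrow>\<^sub>0 'r::comm_ring_1) = 0"
proof -
  obtain p S q where k: "k = (p, set_encode S, q)" and S: "finite S"
    by (rule cell_cases)
  define W :: "nat \<Rightarrow> nat \<Rightarrow> 'g cell \<Rightarrow>\<^sub>0 'r"
    where "W l l' = face (S - {l}) p (prepend_var l q) l' - face (S - {l}) (append_var l p) q l'" for l l'
  have W_sym: "W l l' = W l' l" for l l'
    by (simp add: W_def face_def append_var_commute[of l] prepend_var_commute[of l] Diff_insert2[symmetric]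
        insert_commute algebra_simps)
  have "lin bd (face S p q l) = (\<Sum>l'\<in>S - {l}. smul (koszul_sign s (S - {l}) l') (W l l'))" for l
    using S by (simp add: face_def[of S] lin_diff bd_encode W_def smul_diff_right sum_subtractf)
  then have "lin bd (bd k) = (\<Sum>l\<in>S. \<Sum>l'\<in>S - {l}. smul (koszul_sign s S l * koszul_sign s (S - {l}) l') (W l l'))"
    by (simp add: k bd_encode[OF S] lin_sum lin_smul smul_sum)
  also have "\<dots> = 0"
  proof (rule sum_antisymmetric[OF S])
    fix i j assume "i \<in> S" "j \<in> S" "i \<noteq> j"
    then show "smul (koszul_sign s S i * koszul_sign s (S - {i}) j) (W i j) +
        smul (koszul_sign s S j * koszul_sign s (S - {j}) i) (W j i) = 0"
      by (simp add: W_sym[of j i] koszul_sign_antisymmetric[OF inj_s S] flip: smul_add_left)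
  qed
  finally show ?thesis .
qed


subsection \<open>Exactness\<close>

text \<open>Keeps codes of sets intact, so that cells are compared through their sets of directions
  and not through sums of powers of two.\<close>

declare set_encode_insert [simp del]

text \<open>In the leading direction, the pushed cube has the original cell as near face and the
  remainder as far face. Its other faces are the pushes of the faces of the cell, with opposite sign
  because \<open>m\<close> precedes every direction in \<open>S\<close>, so they cancel.\<close>

lemma homotopy_lead_notin:
  assumes S: "finite S" and ne: "S \<union> Poly_Mapping.keys (expo q) \<noteq> {}" and m: "lead S q \<notin> S"
  shows "Poly_Mapping.single (p, set_encode S, q) 1 - lin bd (hp (p, set_encode S, q)) - lin hp (bd (p, set_encode S, q))
    = (Poly_Mapping.single (append_var (lead S q) p, set_encode S, cancel_var (lead S q) q) 1 :: _ \<Rightarrow>\<^sub>0 'r::comm_ring_1)"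
proof -
  define m where "m = lead S q"
  have mq: "m \<in> Poly_Mapping.keys (expo q)" and mS: "m \<notin> S"
    using lead(1)[OF S ne] m by (auto simp: m_def)
  have least: "s m \<le> s i" if "i \<in> S \<union> Poly_Mapping.keys (expo q)" for i
    using lead(2)[OF S ne that] by (simp add: m_def)
  let ?G = "\<lambda>l. face (insert m S) p (cancel_var m q) l :: _ \<Rightarrow>\<^sub>0 'r"
  have sign: "koszul_sign s (insert m S) l = (- koszul_sign s S l :: 'r)" if l: "l \<in> S" for l
  proof -
    have "s m < s l"
      using least[of l] l mS inj_s by (metis UnI1 injD order_le_less)
    then have "koszul_sign s (insert m S - {m}) l = (- koszul_sign s (insert m S) l :: 'r)"
      using S by (intro koszul_sign_remove_less) auto
    then show ?thesis
      using mS by simp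
  qed
  have "koszul_sign s (insert m S) m = (1 :: 'r)"
    using least by (intro koszul_sign_least) auto
  moreover have "hp (p, set_encode S, q) = (Poly_Mapping.single (p, set_encode (insert m S), cancel_var m q) 1 :: _ \<Rightarrow>\<^sub>0 'r)"
    by (simp only: hp_encode[OF S] ne m m_def simp_thms if_False)
  ultimately have DG: "lin bd (hp (p, set_encode S, q)) = ?G m - (\<Sum>l\<in>S. smul (koszul_sign s S l) (?G l))"
    using S mS sign by (simp add: bd_encode smul_minus_left sum_negf)
  \<comment> \<open>Passing to a face leaves \<open>m\<close> in \<open>q\<close> and adds no
    smaller variable, so both faces are pushed in the same direction \<open>m\<close>.\<close>
  have "lin hp (face S p q l) = ?G l" if l: "l \<in> S" for l
  proof -
    have eq: "insert m S - {l} = insert m (S - {l})"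
      using l mS by auto
    have "lead (S - {l}) (prepend_var l q) = m"
      using S mq least l by (intro lead_eqI) (auto simp: keys_add_nat)
    moreover have "lead (S - {l}) q = m"
      using S mq least l by (intro lead_eqI) (auto simp: keys_add_nat)
    ultimately show ?thesis
      using S mS mq by (auto simp: face_def lin_diff hp_encode keys_add_nat eq cancel_prepend_var_commute)
  qed
  then have "lin hp (bd (p, set_encode S, q)) = (\<Sum>l\<in>S. smul (koszul_sign s S l) (?G l))"
    by (simp add: bd_encode[OF S] lin_sum lin_smul)
  moreover have "?G m = Poly_Mapping.single (p, set_encode S, q) 1
      - Poly_Mapping.single (append_var m p, set_encode S, cancel_var m q) 1"
    using mS mq by (simp add: face_def)
  ultimately show ?thesis
    unfolding DG by (simp add: m_def)
qed

text \<open>The cell itself is not pushed, nor are its faces in directions other than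
  \<open>m\<close>, which still contain the leading direction \<open>m\<close>. The near face in
  direction \<open>m\<close> is pushed back to the cell; the push of the far face remains.\<close>

lemma homotopy_lead_in:
  assumes S: "finite S" and m: "lead S q \<in> S"
  shows "Poly_Mapping.single (p, set_encode S, q) 1 - lin bd (hp (p, set_encode S, q)) - lin hp (bd (p, set_encode S, q))
    = (hp (append_var (lead S q) p, set_encode (S - {lead S q}), q) :: _ \<Rightarrow>\<^sub>0 'r::comm_ring_1)"
proof -
  define m where "m = lead S q"
  have ne: "S \<union> Poly_Mapping.keys (expo q) \<noteq> {}" and mS: "m \<in> S"
    using m by (auto simp: m_def)
  have least: "s m \<le> s i" if "i \<in> S \<union> Poly_Mapping.keys (expo q)" for i
    using lead(2)[OF S ne that] by (simp add: m_def)
  have "lin hp (face S p q l) = (0 :: _ \<Rightarrow>\<^sub>0 'r)" if l: "l \<in> S - {m}" for l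
  proof -
    have "lead (S - {l}) (prepend_var l q) = m"
      using S mS least l by (intro lead_eqI) (auto simp: keys_add_nat)
    moreover have "lead (S - {l}) q = m"
      using S mS least l by (intro lead_eqI) (auto simp: keys_add_nat)
    ultimately show ?thesis
      using S mS l by (auto simp: face_def lin_diff hp_encode)
  qed
  moreover have "lin hp (face S p q m) = Poly_Mapping.single (p, set_encode S, q) 1
      - (hp (append_var m p, set_encode (S - {m}), q) :: _ \<Rightarrow>\<^sub>0 'r)"
  proof -
    have lead: "lead (S - {m}) (prepend_var m q) = m"
      using S mS least by (intro lead_eqI) (auto simp: keys_add_nat)
    have "hp (p, set_encode (S - {m}), prepend_var m q) = (Poly_Mapping.single (p, set_encode S, q) 1 :: _ \<Rightarrow>\<^sub>0 'r)"
      using S mS by (subst hp_encode) (auto simp: keys_add_nat lead insert_absorb)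
    then show ?thesis
      by (simp add: face_def lin_diff)
  qed
  moreover have "koszul_sign s S m = (1 :: 'r)"
    using least by (intro koszul_sign_least) auto
  ultimately have "lin hp (bd (p, set_encode S, q)) = Poly_Mapping.single (p, set_encode S, q) 1
      - (hp (append_var m p, set_encode (S - {m}), q) :: _ \<Rightarrow>\<^sub>0 'r)"
    using S mS by (simp add: bd_encode lin_add lin_sum lin_smul sum.remove[of S m])
  then show ?thesis
    using S m by (simp add: hp_encode m_def)
qed

text \<open>The distance from the far corner of the cube to the end of the box: the measure of the
  descent.\<close>

definition right_degree :: "'g cell \<Rightarrow> nat" where
  "right_degree = (\<lambda>(p, j, q). total_degree (expo q))"

lemma total_degree_cancel_var:
  "l \<in> Poly_Mapping.keys (expo q) \<Longrightarrow> total_degree (expo (cancel_var l q)) < total_degree (expo q)"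
  by (metis var_simps(8) var_plus_minus total_degree_add total_degree_var less_add_same_cancel2 less_one)

lemma right_degree_hp:
  assumes "k' \<in> Poly_Mapping.keys (hp (p, set_encode S, q) :: _ \<Rightarrow>\<^sub>0 'r::comm_ring_1)" "finite S"
  shows "right_degree k' < total_degree (expo q)"
  using assms lead(1)[of S q] total_degree_cancel_var
  by (auto simp: hp_encode right_degree_def split: if_splits)

lemma right_degree_homotopy:
  assumes "k \<in> cells (Suc i)"
    and k': "k' \<in> Poly_Mapping.keys
      (Poly_Mapping.single k 1 - lin bd (hp k) - lin hp (bd k) :: _ \<Rightarrow>\<^sub>0 'r::comm_ring_1)"
  shows "right_degree k' < right_degree k"
proof -
  obtain p S q where k: "k = (p, set_encode S, q)" and S: "finite S"
    by (rule cell_cases)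
  \<comment> \<open>Positive dimension provides a direction, so \<open>lead\<close> is meaningful
    even when \<open>q\<close> is an identity.\<close>
  have ne: "S \<union> Poly_Mapping.keys (expo q) \<noteq> {}"
    using assms(1) S by (auto simp: k mem_cells)
  show ?thesis
  proof (cases "lead S q \<in> S")
    case True
    then show ?thesis
      using right_degree_hp k' S unfolding k homotopy_lead_in[OF S True]
      by (fastforce simp: right_degree_def)
  next
    case False
    then have "lead S q \<in> Poly_Mapping.keys (expo q)"
      using lead(1)[OF S ne] by blast
    then show ?thesis
      using k' total_degree_cancel_var unfolding k homotopy_lead_notin[OF S ne False]
      by (auto simp: right_degree_def split: if_splits)
  qed
qed

definition cell_chains :: "nat \<Rightarrow> ('g cell \<Rightarrow>\<^sub>0 'r::comm_ring_1) set" where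
  "cell_chains i = {x. Poly_Mapping.keys x \<subseteq> cells i}"

lemma lin_mem_keys:
  assumes "Poly_Mapping.keys x \<subseteq> K" "\<And>k. k \<in> K \<Longrightarrow> Poly_Mapping.keys (f k) \<subseteq> L"
  shows "Poly_Mapping.keys (lin f x) \<subseteq> L"
  using assms by (blast elim: keys_lin)

lemma lin_bd_chains: "x \<in> cell_chains (Suc i) \<Longrightarrow> lin bd x \<in> cell_chains i"
  unfolding cell_chains_def mem_Collect_eq by (erule lin_mem_keys) (rule keys_bd)

lemma lin_hp_chains: "x \<in> cell_chains i \<Longrightarrow> lin hp x \<in> cell_chains (Suc i)"
  unfolding cell_chains_def mem_Collect_eq by (erule lin_mem_keys) (rule keys_hp)

lemma lin_bd_lin_bd: "lin bd (lin bd x) = 0"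
  by (simp add: lin_lin bd_bd)

lemma chains_subgroup: "additive_subgroup (cell_chains i)"
  unfolding cell_chains_def by (rule subgroup_keys)

lemma additive_subgroup_image:
  assumes "additive_subgroup S"
  shows "additive_subgroup (lin f ` S)"
proof -
  have "0 \<in> lin f ` S"
    using assms lin_zero[of f] unfolding additive_subgroup_def by (metis image_eqI)
  moreover have "lin f x + lin f y \<in> lin f ` S" if "x \<in> S" "y \<in> S" for x y
    using assms that unfolding additive_subgroup_def by (metis image_eqI lin_add)
  moreover have "- lin f x \<in> lin f ` S" if "x \<in> S" for x
    using assms that unfolding additive_subgroup_def by (metis image_eqI lin_uminus)
  ultimately show ?thesis
    by (auto simp: additive_subgroup_def)
qed

lemma exact_bd:
  "{x \<in> cell_chains (Suc i). lin bd x = (0 :: _ \<Rightarrow>\<^sub>0 'r::comm_ring_1)} = lin bd ` cell_chains (Suc (Suc i))"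
proof (intro subset_antisym subsetI)
  let ?Z = "{x \<in> cell_chains (Suc i). lin bd x = (0 :: _ \<Rightarrow>\<^sub>0 'r)}"
  fix x assume "x \<in> ?Z"
  then show "x \<in> lin bd ` cell_chains (Suc (Suc i))"
  proof (rule boundary_by_descent[where deg = right_degree, rotated 2])
    show "additive_subgroup (lin bd ` cell_chains (Suc (Suc i)))"
      by (intro additive_subgroup_image chains_subgroup)
  next
    fix x assume x: "x \<in> ?Z"
    let ?y = "lin bd (lin hp x)"
    have "lin hp x \<in> cell_chains (Suc (Suc i))"
      using x by (simp add: lin_hp_chains)
    moreover have "?y \<in> cell_chains (Suc i)"
      using x by (simp add: lin_hp_chains lin_bd_chains)
    then have "x - ?y \<in> ?Z"
      using x keys_diff[of x ?y] by (auto simp: lin_diff lin_bd_lin_bd cell_chains_def)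
    moreover have "\<exists>k'\<in>Poly_Mapping.keys x. right_degree k < right_degree k'"
      if k: "k \<in> Poly_Mapping.keys (x - ?y)" for k
    proof -
      \<comment> \<open>For a cycle the missing term of the homotopy formula is zero and can be
        inserted, so the estimate on single cells applies.\<close>
      have "x - ?y = x - ?y - lin hp (lin bd x)"
        using x by simp
      also have "\<dots> = lin (\<lambda>k. Poly_Mapping.single k 1 - lin bd (hp k) - lin hp (bd k)) x"
        by (simp add: lin_diff_fun lin_id lin_lin)
      finally have eq: "x - ?y = \<dots>" .
      from k[unfolded eq] obtain k' where "k' \<in> Poly_Mapping.keys x"
          "k \<in> Poly_Mapping.keys (Poly_Mapping.single k' 1 - lin bd (hp k') - lin hp (bd k') :: _ \<Rightarrow>\<^sub>0 'r)"
        by (rule keys_lin)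
      moreover from this(1) have "k' \<in> cells (Suc i)"
        using x by (auto simp: cell_chains_def)
      ultimately show ?thesis
        using right_degree_homotopy by blast
    qed
    ultimately show "\<exists>y\<in>lin bd ` cell_chains (Suc (Suc i)). x - y \<in> ?Z \<and>
        (\<forall>k\<in>Poly_Mapping.keys (x - y). \<exists>k'\<in>Poly_Mapping.keys x. right_degree k < right_degree k')"
      by (intro bexI[of _ ?y]) auto
  qed
qed (auto simp: lin_bd_chains lin_bd_lin_bd)

section \<open>The augmentation onto the algebra\<close>

definition aug :: "'g cell \<Rightarrow> ('g mono_mor \<Rightarrow>\<^sub>0 'r::comm_ring_1)" where
  "aug = (\<lambda>(p, j, q). Poly_Mapping.single (concat_mor p q) 1)"

text \<open>Sends \<open>p\<close> to \<open>p\<close> tensored with the identity at its end. It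
  splits the augmentation and continues the push \<open>hp\<close> below dimension 0.\<close>

definition sec :: "'g mono_mor \<Rightarrow> ('g cell \<Rightarrow>\<^sub>0 'r::comm_ring_1)" where
  "sec p = Poly_Mapping.single (p, 0, (tgt p, 0, tgt p)) 1"

lemma aug_simps [simp]: "aug (p, j, q) = Poly_Mapping.single (concat_mor p q) 1"
  by (simp add: aug_def)

lemma aug_face: "lin aug (face S p q l) = 0"
  by (simp add: face_def lin_diff concat_append_prepend_var)

lemma aug_bd: "lin aug (bd k) = 0"
proof -
  obtain p S q where "k = (p, set_encode S, q)" "finite S"
    by (rule cell_cases)
  then show ?thesis
    by (simp add: bd_encode lin_sum lin_smul aug_face)
qed

text \<open>In dimension 0 the chains are the tensor square of the algebra over its vertex
  idempotents.\<close>

lemma mem_cells_0: "(p, j, q) \<in> cells 0 \<longleftrightarrow> p \<in> M \<and> q \<in> M \<and> j = 0 \<and> src q = tgt p"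
proof -
  obtain S where S: "j = set_encode S" "finite S"
    by (metis finite_set_decode set_decode_inverse)
  then have "j = 0 \<longleftrightarrow> S = {}"
    using set_encode_eq[of S "{}"] by simp
  then show ?thesis
    using S by (auto simp: mem_cells mem_M)
qed

lemma keys_aug: "k \<in> cells 0 \<Longrightarrow> Poly_Mapping.keys (aug k) \<subseteq> M"
  by (cases k) (auto simp: mem_cells_0 concat_mem_M)

lemma keys_sec: "p \<in> M \<Longrightarrow> Poly_Mapping.keys (sec p) \<subseteq> cells 0"
  by (auto simp: sec_def mem_cells_0) (auto simp: mem_M)

lemma aug_sec: "lin aug (sec p) = Poly_Mapping.single p 1"
  by (simp add: sec_def) (simp add: concat_mor_def src_def expo_def tgt_def)

lemma aug_surj: "lin aug ` cell_chains 0 = {f :: _ \<Rightarrow>\<^sub>0 'r::comm_ring_1. Poly_Mapping.keys f \<subseteq> M}"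
proof (intro subset_antisym subsetI)
  fix f :: "_ \<Rightarrow>\<^sub>0 'r" assume "f \<in> {f. Poly_Mapping.keys f \<subseteq> M}"
  then have "lin sec f \<in> cell_chains 0"
    unfolding cell_chains_def mem_Collect_eq by (rule lin_mem_keys) (rule keys_sec)
  moreover have "lin aug (lin sec f) = f"
    by (simp add: lin_lin aug_sec lin_id)
  ultimately show "f \<in> lin aug ` cell_chains 0"
    by (metis image_eqI)
next
  fix f :: "_ \<Rightarrow>\<^sub>0 'r" assume "f \<in> lin aug ` cell_chains 0"
  then obtain x where x: "f = lin aug x" "Poly_Mapping.keys x \<subseteq> cells 0"
    by (auto simp: cell_chains_def)
  show "f \<in> {f. Poly_Mapping.keys f \<subseteq> M}"
    unfolding x(1) mem_Collect_eq using x(2) keys_aug by (rule lin_mem_keys)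
qed

text \<open>If \<open>q\<close> is an identity, the cell equals its own section and nothing remains.
  Otherwise the push moves one variable out of \<open>q\<close>, and the section term has right
  degree 0.\<close>

lemma right_degree_homotopy_0:
  assumes "k \<in> cells 0"
    and k': "k' \<in> Poly_Mapping.keys
      (Poly_Mapping.single k 1 - lin bd (hp k) - lin sec (aug k) :: _ \<Rightarrow>\<^sub>0 'r::comm_ring_1)"
  shows "right_degree k' < right_degree k"
proof -
  obtain p q where k: "k = (p, set_encode {}, q)" and M: "p \<in> M" "q \<in> M" "src q = tgt p"
    using assms(1) by (cases k) (auto simp: mem_cells_0)
  show ?thesis
  proof (cases "expo q = 0")
    case True
    then have "q = (tgt p, 0, tgt p)" "concat_mor p q = p"
      using M by (auto simp: mem_M intro!: mor_eqI)
    then have "Poly_Mapping.single k 1 - lin bd (hp k) - lin sec (aug k) = (0 :: _ \<Rightarrow>\<^sub>0 'r)"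
      using True by (simp only: k aug_simps lin_single) (simp add: hp_encode[of "{}", simplified] sec_def)
    then show ?thesis
      using k' by (simp only: keys_zero empty_iff)
  next
    case False
    then have ne: "{} \<union> Poly_Mapping.keys (expo q) \<noteq> {}"
      by simp
    then have lq: "lead {} q \<in> Poly_Mapping.keys (expo q)"
      using lead(1)[of "{}" q] by simp
    have "bd (p, set_encode {}, q) = (0 :: _ \<Rightarrow>\<^sub>0 'r)"
      by (subst bd_encode) auto
    then have "Poly_Mapping.single k 1 - lin bd (hp k)
        = (Poly_Mapping.single (append_var (lead {} q) p, set_encode {}, cancel_var (lead {} q) q) 1 :: _ \<Rightarrow>\<^sub>0 'r)"
      using homotopy_lead_notin[OF _ ne, of p, where 'r = 'r] by (simp add: k)
    then have "k' = (append_var (lead {} q) p, set_encode {}, cancel_var (lead {} q) q) \<or>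
        k' = (concat_mor p q, 0, (tgt q, 0, tgt q))"
      using k' keys_diff[of "Poly_Mapping.single k 1 - lin bd (hp k) :: _ \<Rightarrow>\<^sub>0 'r" "lin sec (aug k)"]
      by (auto simp: k sec_def split: if_splits)
    moreover have "0 < total_degree (expo q)"
      using total_degree_cancel_var[OF lq] by linarith
    ultimately show ?thesis
      using total_degree_cancel_var[OF lq] by (auto simp: right_degree_def k)
  qed
qed

lemma exact_aug: "{x \<in> cell_chains 0. lin aug x = (0 :: _ \<Rightarrow>\<^sub>0 'r::comm_ring_1)} = lin bd ` cell_chains 1"
proof (intro subset_antisym subsetI)
  let ?Z = "{x \<in> cell_chains 0. lin aug x = (0 :: _ \<Rightarrow>\<^sub>0 'r)}"
  fix x assume "x \<in> ?Z"
  then show "x \<in> lin bd ` cell_chains 1"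
  proof (rule boundary_by_descent[where deg = right_degree, rotated 2])
    show "additive_subgroup (lin bd ` cell_chains 1)"
      by (intro additive_subgroup_image chains_subgroup)
  next
    fix x assume x: "x \<in> ?Z"
    let ?y = "lin bd (lin hp x)"
    have hp: "lin hp x \<in> cell_chains 1"
      using x lin_hp_chains[of x 0] by simp
    moreover have "?y \<in> cell_chains 0"
      using hp lin_bd_chains[of _ 0] by simp
    then have "x - ?y \<in> ?Z"
      using x keys_diff[of x ?y] by (auto simp: lin_diff lin_lin aug_bd cell_chains_def)
    moreover have "\<exists>k'\<in>Poly_Mapping.keys x. right_degree k < right_degree k'"
      if k: "k \<in> Poly_Mapping.keys (x - ?y)" for k
    proof -
      \<comment> \<open>The inserted section term vanishes because \<open>x\<close> lies in the
        kernel of the augmentation.\<close>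
      have "x - ?y = x - ?y - lin sec (lin aug x)"
        using x by simp
      also have "\<dots> = lin (\<lambda>k. Poly_Mapping.single k 1 - lin bd (hp k) - lin sec (aug k)) x"
        by (simp add: lin_diff_fun lin_id lin_lin)
      finally have eq: "x - ?y = \<dots>" .
      from k[unfolded eq] obtain k' where "k' \<in> Poly_Mapping.keys x"
          "k \<in> Poly_Mapping.keys (Poly_Mapping.single k' 1 - lin bd (hp k') - lin sec (aug k') :: _ \<Rightarrow>\<^sub>0 'r)"
        by (rule keys_lin)
      moreover from this(1) have "k' \<in> cells 0"
        using x by (auto simp: cell_chains_def)
      ultimately show ?thesis
        using right_degree_homotopy_0 by blast
    qed
    ultimately show "\<exists>y\<in>lin bd ` cell_chains 1. x - y \<in> ?Z \<and>
        (\<forall>k\<in>Poly_Mapping.keys (x - y). \<exists>k'\<in>Poly_Mapping.keys x. right_degree k < right_degree k')"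
      by (intro bexI[of _ ?y]) auto
  qed
next
  fix x :: "'g cell \<Rightarrow>\<^sub>0 'r" assume "x \<in> lin bd ` cell_chains 1"
  then show "x \<in> {x \<in> cell_chains 0. lin aug x = (0 :: _ \<Rightarrow>\<^sub>0 'r)}"
    using lin_bd_chains[of _ 0] by (auto simp: lin_lin aug_bd)
qed


subsection \<open>The bimodule structure\<close>

text \<open>On cells this is the total degree of the end of the box, which a cube shares with its
  faces.\<close>

definition cell_degree :: "'g cell \<Rightarrow> nat" where
  "cell_degree = (\<lambda>(p, j, q). path_length N mu p + card (set_decode j) + path_length N mu q)"

definition koszul_bimod ::
  "nat \<Rightarrow> ('g mono_mor \<Rightarrow>\<^sub>0 'r::comm_ring_1, 'g cell \<Rightarrow>\<^sub>0 'r) graded_bimod" where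
  "koszul_bimod i = \<lparr>
     mcar = cell_chains i,
     lact = (\<lambda>f x. lin (\<lambda>r. lin (lact_basis r) x) f),
     ract = (\<lambda>x f. lin (\<lambda>r. lin (ract_basis r) x) f),
     mcomp = (\<lambda>d. {x. Poly_Mapping.keys x \<subseteq> {k \<in> cells i. cell_degree k = d}})\<rparr>"

abbreviation algebra :: "('r::comm_ring_1, 'g mono_mor \<Rightarrow>\<^sub>0 'r) graded_algebra" where
  "algebra \<equiv> bondal_ruan_algebra N mu"

lemma koszul_bimod_simps [simp]:
  "mcar (koszul_bimod i) = cell_chains i"
  "lact (koszul_bimod i) f x = lin (\<lambda>r. lin (lact_basis r) x) f"
  "ract (koszul_bimod i) x f = lin (\<lambda>r. lin (ract_basis r) x) f"
  "mcomp (koszul_bimod i) d = {x. Poly_Mapping.keys x \<subseteq> {k \<in> cells i. cell_degree k = d}}"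
  by (simp_all add: koszul_bimod_def)

lemma bondal_ruan_algebra_simps [simp]:
  "acar algebra = {f. Poly_Mapping.keys f \<subseteq> M}"
  "aone algebra = (\<Sum>v\<in>V. Poly_Mapping.single (v, 0, v) 1)"
  "ascale algebra c f = smul c f"
  "acomp algebra d = {f. Poly_Mapping.keys f \<subseteq> {p \<in> M. path_length N mu p = d}}"
  by (simp_all add: bondal_ruan_algebra_def smul_def)

lemma lin_lin_mem_keys:
  assumes "Poly_Mapping.keys f \<subseteq> L" "Poly_Mapping.keys x \<subseteq> K"
    and "\<And>r k. r \<in> L \<Longrightarrow> k \<in> K \<Longrightarrow> Poly_Mapping.keys (c r k) \<subseteq> K'"
  shows "Poly_Mapping.keys (lin (\<lambda>r. lin (c r) x) f) \<subseteq> K'"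
  using assms by (intro lin_mem_keys[of f L] lin_mem_keys[of x K]) auto

text \<open>The condition on corners depends on \<open>p\<close> only through its target. The
  converse direction is what makes the projection in \<open>projective_koszul\<close> compatible
  with the action.\<close>

lemma concat_cell:
  assumes "r \<in> M" "p \<in> M" "tgt r = src p"
  shows "(concat_mor r p, j, q) \<in> cells i \<longleftrightarrow> (p, j, q) \<in> cells i"
  using assms by (auto simp: cells_def concat_mem_M)

lemma cell_concat:
  assumes "r \<in> M" "q \<in> M" "tgt q = src r"
  shows "(p, j, concat_mor q r) \<in> cells i \<longleftrightarrow> (p, j, q) \<in> cells i"
  using assms by (auto simp: cells_def concat_mem_M)

lemma cells_mem_M: "(p, j, q) \<in> cells i \<Longrightarrow> p \<in> M \<and> q \<in> M \<and> card (set_decode j) = i"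
  by (simp add: cells_def)

lemma keys_lact_basis:
  assumes "r \<in> M" "k \<in> cells i"
  shows "Poly_Mapping.keys (lact_basis r k :: _ \<Rightarrow>\<^sub>0 'r::comm_ring_1) \<subseteq> cells i"
proof -
  obtain p j q where "k = (p, j, q)"
    by (cases k rule: prod_cases3)
  then show ?thesis
    using assms cells_mem_M[of p j q i] concat_cell[of r p j q i] by simp
qed

lemma keys_ract_basis:
  assumes "r \<in> M" "k \<in> cells i"
  shows "Poly_Mapping.keys (ract_basis r k :: _ \<Rightarrow>\<^sub>0 'r::comm_ring_1) \<subseteq> cells i"
proof -
  obtain p j q where "k = (p, j, q)"
    by (cases k rule: prod_cases3)
  then show ?thesis
    using assms cells_mem_M[of p j q i] cell_concat[of r q p j i] by simp
qed

lemma keys_lact_basis_degree: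
  assumes "r \<in> {p \<in> M. path_length N mu p = d}" "k \<in> {k \<in> cells i. cell_degree k = e}"
  shows "Poly_Mapping.keys (lact_basis r k :: _ \<Rightarrow>\<^sub>0 'r::comm_ring_1) \<subseteq> {k \<in> cells i. cell_degree k = d + e}"
proof -
  obtain p j q where "k = (p, j, q)"
    by (cases k rule: prod_cases3)
  then show ?thesis
    using assms cells_mem_M[of p j q i] concat_cell[of r p j q i] path_length_concat[of r p] by (simp add: cell_degree_def)
qed

lemma keys_ract_basis_degree:
  assumes "r \<in> {p \<in> M. path_length N mu p = d}" "k \<in> {k \<in> cells i. cell_degree k = e}"
  shows "Poly_Mapping.keys (ract_basis r k :: _ \<Rightarrow>\<^sub>0 'r::comm_ring_1) \<subseteq> {k \<in> cells i. cell_degree k = e + d}"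
proof -
  obtain p j q where "k = (p, j, q)"
    by (cases k rule: prod_cases3)
  then show ?thesis
    using assms cells_mem_M[of p j q i] cell_concat[of r q p j i] path_length_concat[of q r] by (simp add: cell_degree_def)
qed

lemma lin_sum_fun: "lin (\<lambda>k. \<Sum>i\<in>I. f i k) x = (\<Sum>i\<in>I. lin (f i) x)"
  by (induction I rule: infinite_finite_induct) (simp_all add: lin_add_fun)

text \<open>Exactly one idempotent of the unit fits the source of \<open>p\<close>; finiteness of
  \<open>V\<close> ensures that the sum over \<open>V\<close> contains it.\<close>

lemma lact_aone:
  assumes "x \<in> cell_chains i"
  shows "lin (\<lambda>r. lin (lact_basis r) x) (aone algebra) = x"
proof -
  have "lin (\<lambda>r. lin (lact_basis r) x) (aone algebra) = lin (\<lambda>k. \<Sum>v\<in>V. lact_basis (v, 0, v) k) x"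
    by (simp add: lin_sum lin_sum_fun)
  also have "\<dots> = x"
  proof (rule lin_eq_self)
    fix k assume "k \<in> Poly_Mapping.keys x"
    then have k: "k \<in> cells i"
      using assms by (auto simp: cell_chains_def)
    obtain p j q where pjq: "k = (p, j, q)"
      by (cases k rule: prod_cases3)
    have p: "src p \<in> V"
      using k cells_mem_M[of p j q] by (simp add: pjq mem_M)
    have "(\<Sum>v\<in>V. lact_basis (v, 0, v) k) =
        (\<Sum>v\<in>V. if v = src p then Poly_Mapping.single (concat_mor (src p, 0, src p) p, j, q) 1 else 0)"
      unfolding pjq by (rule sum.cong) auto
    also have "concat_mor (src p, 0, src p) p = p"
      by (rule mor_eqI) simp_all
    finally show "(\<Sum>v\<in>V. lact_basis (v, 0, v) k) = Poly_Mapping.single k 1"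
      using p by (simp add: pjq finite_im_Phi)
  qed
  finally show ?thesis .
qed

lemma ract_aone:
  assumes "x \<in> cell_chains i"
  shows "lin (\<lambda>r. lin (ract_basis r) x) (aone algebra) = x"
proof -
  have "lin (\<lambda>r. lin (ract_basis r) x) (aone algebra) = lin (\<lambda>k. \<Sum>v\<in>V. ract_basis (v, 0, v) k) x"
    by (simp add: lin_sum lin_sum_fun)
  also have "\<dots> = x"
  proof (rule lin_eq_self)
    fix k assume "k \<in> Poly_Mapping.keys x"
    then have k: "k \<in> cells i"
      using assms by (auto simp: cell_chains_def)
    obtain p j q where pjq: "k = (p, j, q)"
      by (cases k rule: prod_cases3)
    have q: "tgt q \<in> V"
      using k cells_mem_M[of p j q] by (simp add: pjq mem_M)
    have "(\<Sum>v\<in>V. ract_basis (v, 0, v) k) =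
        (\<Sum>v\<in>V. if v = tgt q then Poly_Mapping.single (p, j, concat_mor q (tgt q, 0, tgt q)) 1 else 0)"
      unfolding pjq by (rule sum.cong) auto
    also have "concat_mor q (tgt q, 0, tgt q) = q"
      by (rule mor_eqI) simp_all
    finally show "(\<Sum>v\<in>V. ract_basis (v, 0, v) k) = Poly_Mapping.single k 1"
      using q by (simp add: pjq finite_im_Phi)
  qed
  finally show ?thesis .
qed

lemma lact_basis_mult:
  fixes x :: "'g cell \<Rightarrow>\<^sub>0 'r::comm_ring_1"
  shows "lin (\<lambda>r. lin (lact_basis r) x) (mult_basis a b) = lin (lact_basis a) (lin (lact_basis b) x)"
proof -
  have "lin (lact_basis a) (lact_basis b k) = (if tgt a = src b then lact_basis (concat_mor a b) k else (0 :: _ \<Rightarrow>\<^sub>0 'r))" for k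
    by (cases k rule: prod_cases3) (simp add: concat_mor_assoc)
  then show ?thesis
    by (simp add: lin_lin mult_basis_def)
qed

lemma ract_basis_mult:
  fixes x :: "'g cell \<Rightarrow>\<^sub>0 'r::comm_ring_1"
  shows "lin (\<lambda>r. lin (ract_basis r) x) (mult_basis a b) = lin (ract_basis b) (lin (ract_basis a) x)"
proof -
  have "lin (ract_basis b) (ract_basis a k) = (if tgt a = src b then ract_basis (concat_mor a b) k else (0 :: _ \<Rightarrow>\<^sub>0 'r))" for k
    by (cases k rule: prod_cases3) (simp add: concat_mor_assoc)
  then show ?thesis
    by (simp add: lin_lin mult_basis_def)
qed

lemma ract_lact_basis: "lin (ract_basis b) (lact_basis a k) = lin (lact_basis a) (ract_basis b k)"
  by (cases k rule: prod_cases3) simp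

lemma graded_bimodule_koszul:
  "graded_bimodule algebra (koszul_bimod i :: (_ \<Rightarrow>\<^sub>0 'r::comm_ring_1, _) graded_bimod)"
proof (unfold_locales, goal_cases)
  case 1
  show ?case by (simp add: chains_subgroup)
next
  case (2 a x)
  then show ?case
    using lin_lin_mem_keys[OF _ _ keys_lact_basis] by (simp add: cell_chains_def)
next
  case (3 a x)
  then show ?case
    using lin_lin_mem_keys[OF _ _ keys_ract_basis] by (simp add: cell_chains_def)
next
  case (8 a b x)
  show ?case
    by (simp add: amult_bondal_ruan lin_lin lact_basis_mult)
next
  case (9 a b x)
  show ?case
    by (simp add: amult_bondal_ruan lin_lin ract_basis_mult) (simp add: lin_lin lin_swap[of _ a])
next
  case (10 a b x)
  show ?case
    by (simp add: lin_lin lin_swap[of _ b a] ract_lact_basis)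
next
  case (11 x)
  then show ?case using lact_aone by simp
next
  case (12 x)
  then show ?case using ract_aone by simp
next
  case (13 x c)
  then show ?case
    using lact_aone[of x i] ract_aone[of x i] by (simp add: lin_smul)
next
  case 14
  have "mcomp (koszul_bimod i :: (_ \<Rightarrow>\<^sub>0 'r, _) graded_bimod) = (\<lambda>d. {x. Poly_Mapping.keys x \<subseteq> {k \<in> cells i. cell_degree k = d}})"
    by (rule ext) simp
  then show ?case
    by (simp add: cell_chains_def is_grading_keys)
next
  case (15 a d x e)
  then have "Poly_Mapping.keys a \<subseteq> {p \<in> M. path_length N mu p = d}"
      "Poly_Mapping.keys x \<subseteq> {k \<in> cells i. cell_degree k = e}"
    by simp_all
  then have "Poly_Mapping.keys (lin (\<lambda>r. lin (lact_basis r) x) a) \<subseteq> {k \<in> cells i. cell_degree k = d + e}"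
    by (rule lin_lin_mem_keys) (rule keys_lact_basis_degree)
  then show ?case
    by simp
next
  case (16 a d x e)
  then have "Poly_Mapping.keys a \<subseteq> {p \<in> M. path_length N mu p = d}"
      "Poly_Mapping.keys x \<subseteq> {k \<in> cells i. cell_degree k = e}"
    by simp_all
  then have "Poly_Mapping.keys (lin (\<lambda>r. lin (ract_basis r) x) a) \<subseteq> {k \<in> cells i. cell_degree k = e + d}"
    by (rule lin_lin_mem_keys) (rule keys_ract_basis_degree)
  then show ?case
    by simp
qed (simp_all add: lin_add lin_add_fun)

text \<open>Basis elements of a free bimodule that are cells, and those that are not, are each
  stable under both actions. Discarding the latter is therefore a retraction. A generator for every
  code \<open>j\<close>, placed in the degree of its dimension, makes the gradings match.\<close>

lemma projective_koszul:
  "projective_bimod N mu (koszul_bimod i :: (_ \<Rightarrow>\<^sub>0 'r::comm_ring_1, _) graded_bimod)"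
proof -
  let ?P = "koszul_bimod i :: (_ \<Rightarrow>\<^sub>0 'r, _) graded_bimod"
  let ?F = "free_bimod N mu UNIV (\<lambda>j. card (set_decode j)) :: (_ \<Rightarrow>\<^sub>0 'r, _) graded_bimod"
  define pr :: "'g cell \<Rightarrow> 'g cell \<Rightarrow>\<^sub>0 'r"
    where "pr k = (if k \<in> cells i then Poly_Mapping.single k 1 else 0)" for k
  have keys_pr: "Poly_Mapping.keys (pr k) \<subseteq> {k} \<inter> cells i" for k
    by (simp add: pr_def)
  have F: "mcar ?F = {x. Poly_Mapping.keys x \<subseteq> M \<times> UNIV \<times> M}"
    "mcomp ?F d = {x. Poly_Mapping.keys x \<subseteq> {k \<in> M \<times> UNIV \<times> M. cell_degree k = d}}" for d
    by (auto simp: free_bimod_def cell_degree_def)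
  have cells_M: "cells i \<subseteq> M \<times> UNIV \<times> M"
    by (auto simp: cells_def)
  have l: "lin pr (lact_basis r k) = lin (lact_basis r) (pr k)"
    and r: "lin pr (ract_basis r k) = lin (ract_basis r) (pr k)"
    if "r \<in> M" "k \<in> M \<times> UNIV \<times> M" for r k
  proof -
    obtain p j q where k: "k = (p, j, q)"
      by (cases k rule: prod_cases3)
    show "lin pr (lact_basis r k) = lin (lact_basis r) (pr k)"
      using that concat_cell[of r p j q i] by (simp add: k pr_def)
    show "lin pr (ract_basis r k) = lin (ract_basis r) (pr k)"
      using that cell_concat[of r q p j i] by (simp add: k pr_def)
  qed
  have l': "lin pr (lin (\<lambda>r. lin (lact_basis r) x) f) = lin (\<lambda>r. lin (lact_basis r) (lin pr x)) f"
    and r': "lin pr (lin (\<lambda>r. lin (ract_basis r) x) f) = lin (\<lambda>r. lin (ract_basis r) (lin pr x)) f"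
    if "Poly_Mapping.keys f \<subseteq> M" "Poly_Mapping.keys x \<subseteq> M \<times> UNIV \<times> M" for f x
    using that by (auto simp: lin_lin intro!: lin_cong l r)
  show ?thesis
    unfolding projective_bimod_def
  proof (intro exI conjI ballI)
    show "graded_hom algebra ?P ?F (\<lambda>x. x)"
      using cells_M by (auto simp: graded_hom_def F lact_free_bimod ract_free_bimod cell_chains_def)
    show "graded_hom algebra ?F ?P (lin pr)"
      unfolding graded_hom_def
    proof (intro conjI allI ballI)
      show "lin pr ` mcar ?F \<subseteq> mcar ?P"
      proof
        fix y assume "y \<in> lin pr ` mcar ?F"
        then obtain x where x: "y = lin pr x" "Poly_Mapping.keys x \<subseteq> M \<times> UNIV \<times> M"
          by (auto simp: F)
        have "Poly_Mapping.keys y \<subseteq> cells i"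
          unfolding x(1) using x(2) by (rule lin_mem_keys) (use keys_pr in blast)
        then show "y \<in> mcar ?P"
          by (simp add: cell_chains_def)
      qed
      show "lin pr ` mcomp ?F d \<subseteq> mcomp ?P d" for d
      proof
        fix y assume "y \<in> lin pr ` mcomp ?F d"
        then obtain x where x: "y = lin pr x" "Poly_Mapping.keys x \<subseteq> {k \<in> M \<times> UNIV \<times> M. cell_degree k = d}"
          by (auto simp: F)
        have "Poly_Mapping.keys y \<subseteq> {k \<in> cells i. cell_degree k = d}"
          unfolding x(1) using x(2) by (rule lin_mem_keys) (use keys_pr in blast)
        then show "y \<in> mcomp ?P d"
          by simp
      qed
    qed (simp_all add: lin_add F lact_free_bimod ract_free_bimod l' r')
    show "lin pr x = x" if "x \<in> mcar ?P" for x
      using that by (intro lin_eq_self) (auto simp: pr_def cell_chains_def)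
  qed
qed

text \<open>A cell is obtained from the cell with identities at both ends by acting with
  \<open>p\<close> on the left and with \<open>q\<close> on the right; the latter has degree
  \<open>i\<close>, its dimension.\<close>

lemma generated_koszul:
  "generated_in_degree algebra (koszul_bimod i :: (_ \<Rightarrow>\<^sub>0 'r::comm_ring_1, _) graded_bimod) i"
  unfolding generated_in_degree_def
proof (intro allI impI)
  let ?P = "koszul_bimod i :: (_ \<Rightarrow>\<^sub>0 'r, _) graded_bimod"
  fix S assume S: "additive_subgroup S" "S \<subseteq> mcar ?P" "mcomp ?P i \<subseteq> S"
    and closed: "\<forall>a\<in>acar algebra. \<forall>x\<in>S. lact ?P a x \<in> S \<and> ract ?P x a \<in> S"
  have "smul c (Poly_Mapping.single k 1) \<in> S" if "k \<in> cells i" for k c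
  proof -
    obtain p j q where k: "k = (p, j, q)"
      by (cases k rule: prod_cases3)
    let ?p = "(tgt p, 0, tgt p)" and ?q = "(src q, 0, src q)"
    have M: "p \<in> M" "q \<in> M" "card (set_decode j) = i"
      using that cells_mem_M unfolding k by auto
    have gen: "(?p, j, ?q) \<in> cells i"
      using that unfolding k by (auto simp: cells_def mem_M)
    have "Poly_Mapping.single (?p, j, ?q) c \<in> mcomp ?P i"
      using gen M by (auto simp: cell_degree_def path_length_eq mem_M)
    moreover have "Poly_Mapping.single p 1 \<in> acar (algebra :: ('r, _) graded_algebra)"
        "Poly_Mapping.single q 1 \<in> acar (algebra :: ('r, _) graded_algebra)"
      using M by simp_all
    ultimately have "ract ?P (lact ?P (Poly_Mapping.single p 1) (Poly_Mapping.single (?p, j, ?q) c))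
        (Poly_Mapping.single q 1) \<in> S"
      using closed S(3) by blast
    moreover have "concat_mor p ?p = p" "concat_mor ?q q = q"
      by (rule mor_eqI; simp)+
    ultimately show ?thesis
      by (simp add: k lin_smul)
  qed
  then have "lin (\<lambda>k. Poly_Mapping.single k 1) x \<in> S" if "x \<in> cell_chains i" for x
    using that by (intro lin_mem_subgroup[OF S(1)]) (auto simp only: cell_chains_def)
  then have "x \<in> S" if "x \<in> cell_chains i" for x
    using that by (simp add: lin_id)
  then show "S = mcar ?P"
    using S(2) by auto
qed

text \<open>Faces change \<open>p\<close> only at its end, while the left action extends it at its
  start.\<close>

lemma bd_lact: "lin bd (lact_basis r k) = (lin (lact_basis r) (bd k) :: _ \<Rightarrow>\<^sub>0 'r::comm_ring_1)"
proof -
  obtain p S q where k: "k = (p, set_encode S, q)" and S: "finite S"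
    by (rule cell_cases)
  have "lin (lact_basis r) (face S p q l) = (if tgt r = src p then face S (concat_mor r p) q l else (0 :: _ \<Rightarrow>\<^sub>0 'r))" for l
    by (simp add: face_def lin_diff concat_append_var)
  then show ?thesis
    by (simp add: k bd_encode[OF S] lin_sum lin_smul)
qed

lemma bd_ract: "lin bd (ract_basis r k) = (lin (ract_basis r) (bd k) :: _ \<Rightarrow>\<^sub>0 'r::comm_ring_1)"
proof -
  obtain p S q where k: "k = (p, set_encode S, q)" and S: "finite S"
    by (rule cell_cases)
  have "lin (ract_basis r) (face S p q l) = (if tgt q = src r then face S p (concat_mor q r) l else (0 :: _ \<Rightarrow>\<^sub>0 'r))" for l
    by (simp add: face_def lin_diff concat_prepend_var)
  then show ?thesis
    by (simp add: k bd_encode[OF S] lin_sum lin_smul)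
qed

text \<open>Each face trades one dimension for one variable in \<open>p\<close> or
  \<open>q\<close>.\<close>

lemma cell_degree_bd:
  assumes "k \<in> cells (Suc i)" "k' \<in> Poly_Mapping.keys (bd k :: _ \<Rightarrow>\<^sub>0 'r::comm_ring_1)"
  shows "cell_degree k' = cell_degree k"
proof -
  obtain p S q where k: "k = (p, set_encode S, q)" and S: "finite S"
    by (rule cell_cases)
  have "k' \<in> (\<Union>l\<in>S. Poly_Mapping.keys (smul (koszul_sign s S l) (face S p q l) :: _ \<Rightarrow>\<^sub>0 'r))"
    using assms(2) keys_sum unfolding k bd_encode[OF S] by (rule subsetD[rotated])
  then obtain l where l: "l \<in> S" "k' \<in> Poly_Mapping.keys (face S p q l :: _ \<Rightarrow>\<^sub>0 'r)"
    using keys_smul by fast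
  then have "k' = (p, set_encode (S - {l}), prepend_var l q) \<or> k' = (append_var l p, set_encode (S - {l}), q)"
    unfolding face_def using keys_diff by fastforce
  moreover have "prepend_var l q \<in> M" "append_var l p \<in> M" "p \<in> M" "q \<in> M"
    using cell_remove[OF S l(1), of p q i] assms(1) S unfolding k by (auto simp: mem_cells)
  moreover have "card S = Suc (card (S - {l}))"
    using S l(1) by (rule card.remove)
  ultimately show ?thesis
    using S by (auto simp: k cell_degree_def path_length_eq total_degree_add)
qed

lemma graded_hom_bd:
  "graded_hom algebra (koszul_bimod (Suc i) :: (_ \<Rightarrow>\<^sub>0 'r::comm_ring_1, _) graded_bimod) (koszul_bimod i) (lin bd)"
  unfolding graded_hom_def
proof (intro conjI allI ballI)
  show "lin bd ` mcomp (koszul_bimod (Suc i)) d \<subseteq> mcomp (koszul_bimod i :: (_ \<Rightarrow>\<^sub>0 'r, _) graded_bimod) d" for d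
  proof
    fix y :: "_ \<Rightarrow>\<^sub>0 'r" assume "y \<in> lin bd ` mcomp (koszul_bimod (Suc i)) d"
    then obtain x where x: "y = lin bd x" "Poly_Mapping.keys x \<subseteq> {k \<in> cells (Suc i). cell_degree k = d}"
      by auto
    have "Poly_Mapping.keys y \<subseteq> {k \<in> cells i. cell_degree k = d}"
      unfolding x(1) using x(2)
    proof (rule lin_mem_keys)
      fix k assume "k \<in> {k \<in> cells (Suc i). cell_degree k = d}"
      then show "Poly_Mapping.keys (bd k :: _ \<Rightarrow>\<^sub>0 'r) \<subseteq> {k \<in> cells i. cell_degree k = d}"
        using keys_bd cell_degree_bd by blast
    qed
    then show "y \<in> mcomp (koszul_bimod i) d"
      by simp
  qed
qed (auto simp: lin_add lin_bd_chains lin_lin bd_lact bd_ract)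

lemma aug_lact: "lin aug (lact_basis r k) = (lin (mult_basis r) (aug k) :: _ \<Rightarrow>\<^sub>0 'r::comm_ring_1)"
  by (cases k rule: prod_cases3) (simp add: mult_basis_def concat_mor_assoc)

lemma aug_ract: "lin aug (ract_basis r k) = (lin (\<lambda>p. mult_basis p r) (aug k) :: _ \<Rightarrow>\<^sub>0 'r::comm_ring_1)"
  by (cases k rule: prod_cases3) (simp add: mult_basis_def concat_mor_assoc)

lemma graded_hom_aug:
  "graded_hom algebra (koszul_bimod 0) (regular_bimod algebra) (lin aug :: _ \<Rightarrow> _ \<Rightarrow>\<^sub>0 'r::comm_ring_1)"
  unfolding graded_hom_def
proof (intro conjI allI ballI)
  show "lin aug ` mcar (koszul_bimod 0) \<subseteq> mcar (regular_bimod (algebra :: ('r, _) graded_algebra))"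
    using aug_surj[where 'r = 'r] by (simp add: regular_bimod_def)
next
  fix x y :: "'g cell \<Rightarrow>\<^sub>0 'r"
  show "lin aug (x + y) = lin aug x + lin aug y"
    by (rule lin_add)
next
  fix a :: "'g mono_mor \<Rightarrow>\<^sub>0 'r" and x :: "'g cell \<Rightarrow>\<^sub>0 'r"
  show "lin aug (lact (koszul_bimod 0) a x) = lact (regular_bimod algebra) a (lin aug x)"
    by (simp add: regular_bimod_def amult_bondal_ruan lin_lin aug_lact)
  show "lin aug (ract (koszul_bimod 0) x a) = ract (regular_bimod algebra) (lin aug x) a"
    by (simp add: regular_bimod_def amult_bondal_ruan lin_lin aug_ract lin_swap[where x = a])
next
  fix d
  show "lin aug ` mcomp (koszul_bimod 0) d \<subseteq> mcomp (regular_bimod (algebra :: ('r, _) graded_algebra)) d"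
  proof
    fix y :: "_ \<Rightarrow>\<^sub>0 'r" assume "y \<in> lin aug ` mcomp (koszul_bimod 0) d"
    then obtain x where x: "y = lin aug x" "Poly_Mapping.keys x \<subseteq> {k \<in> cells 0. cell_degree k = d}"
      by auto
    have "Poly_Mapping.keys y \<subseteq> {p \<in> M. path_length N mu p = d}"
      unfolding x(1) using x(2)
    proof (rule lin_mem_keys)
      fix k assume k: "k \<in> {k \<in> cells 0. cell_degree k = d}"
      obtain p j q where "k = (p, j, q)"
        by (cases k rule: prod_cases3)
      then show "Poly_Mapping.keys (aug k :: _ \<Rightarrow>\<^sub>0 'r) \<subseteq> {p \<in> M. path_length N mu p = d}"
        using k by (auto simp: mem_cells_0 concat_mem_M path_length_concat cell_degree_def)
    qed
    then show "y \<in> mcomp (regular_bimod algebra) d"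
      by (simp add: regular_bimod_def)
  qed
qed

lemma koszul_if_homogeneous:
  assumes "homogeneous_relations N mu"
  shows "koszul TYPE('r::comm_ring_1) N mu"
  unfolding koszul_def Let_def
proof (intro conjI exI allI)
  show "homogeneous_relations N mu" by fact
  show "graded_bimodule (algebra :: ('r, _) graded_algebra) (koszul_bimod i)" for i
    by (rule graded_bimodule_koszul)
  show "projective_bimod N mu (koszul_bimod i :: (_ \<Rightarrow>\<^sub>0 'r, _) graded_bimod)" for i
    by (rule projective_koszul)
  show "generated_in_degree algebra (koszul_bimod i :: (_ \<Rightarrow>\<^sub>0 'r, _) graded_bimod) i" for i
    by (rule generated_koszul)
  show "graded_hom algebra (koszul_bimod (Suc i) :: (_ \<Rightarrow>\<^sub>0 'r, _) graded_bimod) (koszul_bimod i) (lin bd)" for i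
    by (rule graded_hom_bd)
  show "graded_hom (algebra :: ('r, _) graded_algebra) (koszul_bimod 0) (regular_bimod algebra) (lin aug)"
    by (rule graded_hom_aug)
  show "lin aug ` mcar (koszul_bimod 0) = acar (algebra :: ('r, _) graded_algebra)"
    using aug_surj[where 'r = 'r] by simp
  show "{x \<in> mcar (koszul_bimod 0). lin aug x = (0 :: _ \<Rightarrow>\<^sub>0 'r)} = lin bd ` mcar (koszul_bimod 1)"
    using exact_aug by simp
  show "{x \<in> mcar (koszul_bimod (Suc i)). lin bd x = (0 :: _ \<Rightarrow>\<^sub>0 'r)} = lin bd ` mcar (koszul_bimod (Suc (Suc i)))" for i
    using exact_bd by simp
qed

end


section \<open>Finiteness of the image of Phi\<close>

lemma lookup_scaleR_poly_mapping [simp]: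
  "Poly_Mapping.lookup (r *\<^sub>R x) i = r *\<^sub>R Poly_Mapping.lookup x i" for x :: "'k \<Rightarrow>\<^sub>0 real"
proof -
  have "finite {i. r *\<^sub>R Poly_Mapping.lookup x i \<noteq> 0}"
    by (rule finite_subset[OF _ finite_keys[of x]]) (auto simp: in_keys_iff)
  then show ?thesis
    by (simp add: scaleR_poly_mapping_def)
qed

definition real_vec :: "(nat \<Rightarrow>\<^sub>0 int) \<Rightarrow> (nat \<Rightarrow>\<^sub>0 real)" where
  "real_vec u = Poly_Mapping.map real_of_int u"

lemma lookup_real_vec [simp]: "Poly_Mapping.lookup (real_vec u) i = real_of_int (Poly_Mapping.lookup u i)"
  by (simp add: real_vec_def map.rep_eq when_def)

lemma real_vec_add: "real_vec (u + v) = real_vec u + real_vec v"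
  by (rule poly_mapping_eqI) (simp add: lookup_add)

lemma real_vec_diff: "real_vec (u - v) = real_vec u - real_vec v"
  by (rule poly_mapping_eqI) (simp add: lookup_minus)

lemma vecs_add: "u \<in> vecs N \<Longrightarrow> v \<in> vecs N \<Longrightarrow> u + v \<in> vecs N" for u v :: "nat \<Rightarrow>\<^sub>0 int"
  using keys_add[of u v] by (auto simp: vecs_def)

lemma vecs_diff: "u \<in> vecs N \<Longrightarrow> v \<in> vecs N \<Longrightarrow> u - v \<in> vecs N" for u v :: "nat \<Rightarrow>\<^sub>0 int"
  using keys_diff[of u v] by (auto simp: vecs_def)

lemma vecs_uminus: "u \<in> vecs N \<Longrightarrow> - u \<in> vecs N" for u :: "nat \<Rightarrow>\<^sub>0 int"
  by (simp add: vecs_def)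

text \<open>Passes from the quotient to the free vector space, where a functional vanishing on
  \<open>tensor_relations\<close> can be evaluated.\<close>

lemma mu_real_eq_zero_iff:
  "mu_real N mu a = 0 \<longleftrightarrow>
    (\<Sum>i<N. Poly_Mapping.lookup a i *\<^sub>R Poly_Mapping.single (mu (Poly_Mapping.single i 1)) 1) \<in> tensor_relations"
proof -
  have "mu_real N mu a = abs_real_tensor
      (\<Sum>i<N. Poly_Mapping.lookup a i *\<^sub>R Poly_Mapping.single (mu (Poly_Mapping.single i 1)) 1)"
    unfolding mu_real_def
    by (induction N) (simp_all add: zero_real_tensor_def to_real_tensor.abs_eq
        plus_real_tensor.abs_eq scaleR_real_tensor.abs_eq)
  then show ?thesis
    by (simp add: zero_real_tensor_def real_tensor.abs_eq_iff)
qed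

lemma finite_bounded_vecs: "finite {w \<in> vecs N. \<forall>i<N. \<bar>Poly_Mapping.lookup w i\<bar> \<le> (C::int)}"
proof (rule finite_imageD)
  let ?r = "\<lambda>w. restrict (Poly_Mapping.lookup w) {..<N}"
  show "finite (?r ` {w \<in> vecs N. \<forall>i<N. \<bar>Poly_Mapping.lookup w i\<bar> \<le> C})"
  proof (rule finite_subset)
    show "?r ` {w \<in> vecs N. \<forall>i<N. \<bar>Poly_Mapping.lookup w i\<bar> \<le> C} \<subseteq> PiE {..<N} (\<lambda>_. {- C..C})"
      by (rule image_subsetI) (auto simp: restrict_PiE_iff abs_le_iff minus_le_iff)
    show "finite (PiE {..<N} (\<lambda>_. {- C..C}))"
      by (intro finite_PiE) auto
  qed
  show "inj_on ?r {w \<in> vecs N. \<forall>i<N. \<bar>Poly_Mapping.lookup w i\<bar> \<le> C}"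
  proof (rule inj_onI, rule poly_mapping_eqI)
    fix v w i
    assume "v \<in> {w \<in> vecs N. \<forall>i<N. \<bar>Poly_Mapping.lookup w i\<bar> \<le> C}"
      "w \<in> {w \<in> vecs N. \<forall>i<N. \<bar>Poly_Mapping.lookup w i\<bar> \<le> C}" and eq: "?r v = ?r w"
    then have "i \<notin> {..<N} \<Longrightarrow> Poly_Mapping.lookup v i = 0 \<and> Poly_Mapping.lookup w i = 0"
      by (auto simp: vecs_def in_keys_iff)
    then show "Poly_Mapping.lookup v i = Poly_Mapping.lookup w i"
      using fun_cong[OF eq, of i] by (cases "i < N") auto
  qed
qed

context toric_stack
begin

lemma mu_diff: "u \<in> vecs (n + k) \<Longrightarrow> v \<in> vecs (n + k) \<Longrightarrow> mu (u - v) = mu u - mu v"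
  using mu_add[of "u - v" v] by (simp add: vecs_diff)

text \<open>Flatness of the reals over the integers.\<close>

lemma kernel_real_subset_span:
  assumes "a \<in> kernel_real (n + k) mu"
  shows "a \<in> span (real_vec ` kernel_lattice (n + k) mu)"
proof (rule ccontr)
  let ?N = "n + k"
  let ?K = "real_vec ` kernel_lattice ?N mu"
  assume a: "a \<notin> span ?K"
  \<comment> \<open>If \<open>a\<close> is outside the span, a functional \<open>phi\<close> can be
    prescribed as 0 on this basis and 1 at \<open>a\<close>.\<close>
  obtain B where B: "B \<subseteq> ?K" "independent B" "?K \<subseteq> span B"
    by (rule maximal_independent_subset)
  have "a \<notin> span B"
    using a span_mono[OF B(1)] by blast
  then have "independent (insert a B)"
    using B(2) by (simp add: independent_insertI)
  then obtain phi :: "(nat \<Rightarrow>\<^sub>0 real) \<Rightarrow> real"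
    where phi: "linear phi" "\<forall>x\<in>insert a B. phi x = (if x = a then 1 else 0)"
    using linear_independent_extend[of "insert a B" "\<lambda>x. if x = a then 1 else 0 :: real"] by blast
  have phi_B: "phi x = 0" if "x \<in> B" for x
    using that phi(2) \<open>a \<notin> span B\<close> by (auto dest: span_base)
  have phi_K: "phi (real_vec u) = 0" if "u \<in> kernel_lattice ?N mu" for u
    using linear_eq_0_on_span[OF phi(1) phi_B] B(3) that by blast
  \<comment> \<open>Since \<open>phi\<close> vanishes on the lattice kernel, it descends to an
    additive function on the character group, whatever preimage is chosen.\<close>
  define psi where "psi g = phi (real_vec (SOME u. u \<in> vecs ?N \<and> mu u = g))" for g
  have psi_mu: "psi (mu u) = phi (real_vec u)" if u: "u \<in> vecs ?N" for u
  proof -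
    define v where "v = (SOME v. v \<in> vecs ?N \<and> mu v = mu u)"
    have v: "v \<in> vecs ?N \<and> mu v = mu u"
      unfolding v_def by (rule someI[of _ u]) (use u in simp)
    then have "v - u \<in> kernel_lattice ?N mu"
      using u by (simp add: kernel_lattice_def vecs_diff mu_diff)
    then show ?thesis
      using phi_K[of "v - u"] phi(1) by (simp add: psi_def v_def[symmetric] real_vec_diff linear_diff)
  qed
  have psi_add: "psi (g + h) = psi g + psi h" for g h
  proof -
    obtain u v where "u \<in> vecs ?N" "g = mu u" "v \<in> vecs ?N" "h = mu v"
      using mu_surj by (metis UNIV_I image_iff)
    then show ?thesis
      using phi(1) by (simp add: psi_mu vecs_add real_vec_add linear_add flip: mu_add)
  qed
  \<comment> \<open>The linear extension of \<open>psi\<close> kills the tensor relations. Evaluated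
    on the relation witnessing \<open>mu_real\<close> of \<open>a\<close> to be 0, it returns
    \<open>phi a\<close>, which is 1.\<close>
  define E where "E x = (\<Sum>g\<in>Poly_Mapping.keys x. Poly_Mapping.lookup x g * psi g)" for x :: "_ \<Rightarrow>\<^sub>0 real"
  have E_single [simp]: "E (Poly_Mapping.single g c) = c * psi g" for g c
    by (simp add: E_def)
  have "linear E"
  proof (rule linearI)
    show "E (x + y) = E x + E y" for x y
      unfolding E_def by (rule setsum_keys_plus_distrib) (simp_all add: distrib_right)
    show "E (r *\<^sub>R x) = r *\<^sub>R E x" for r x
    proof -
      have "E (r *\<^sub>R x) = (\<Sum>g\<in>Poly_Mapping.keys x. Poly_Mapping.lookup (r *\<^sub>R x) g * psi g)"
        unfolding E_def by (rule sum.mono_neutral_left) (auto simp: in_keys_iff)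
      then show ?thesis
        by (simp add: E_def sum_distrib_left mult.assoc)
    qed
  qed
  have E_rel: "E x = 0" if "x \<in> tensor_relations" for x
    by (rule linear_eq_0_on_span[OF \<open>linear E\<close> _ that[unfolded tensor_relations_def]]) (auto simp: linear_diff[OF \<open>linear E\<close>] psi_add)
  have av: "a \<in> vecs ?N" and "mu_real ?N mu a = 0"
    using assms by (simp_all add: kernel_real_def)
  then have "0 = E (\<Sum>i<?N. Poly_Mapping.lookup a i *\<^sub>R Poly_Mapping.single (mu (Poly_Mapping.single i 1)) 1)"
    by (simp add: mu_real_eq_zero_iff E_rel)
  also have "\<dots> = (\<Sum>i<?N. Poly_Mapping.lookup a i * phi (real_vec (Poly_Mapping.single i 1)))"
    by (simp add: linear_sum[OF \<open>linear E\<close>] linear_scale[OF \<open>linear E\<close>] psi_mu vecs_def)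
  also have "\<dots> = phi (\<Sum>i<?N. Poly_Mapping.lookup a i *\<^sub>R real_vec (Poly_Mapping.single i 1))"
    by (simp add: linear_sum[OF phi(1)] linear_scale[OF phi(1)])
  also have "(\<Sum>i<?N. Poly_Mapping.lookup a i *\<^sub>R real_vec (Poly_Mapping.single i 1)) = a"
  proof (rule poly_mapping_eqI)
    fix i
    have "Poly_Mapping.lookup (\<Sum>i<?N. Poly_Mapping.lookup a i *\<^sub>R real_vec (Poly_Mapping.single i 1)) i
        = (\<Sum>j<?N. if j = i then Poly_Mapping.lookup a i else 0)"
      unfolding lookup_sum by (rule sum.cong) (auto simp: lookup_single when_def)
    also have "\<dots> = Poly_Mapping.lookup a i"
      using av by (auto simp: vecs_def in_keys_iff)
    finally show "Poly_Mapping.lookup (\<Sum>i<?N. Poly_Mapping.lookup a i *\<^sub>R real_vec (Poly_Mapping.single i 1)) i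
        = Poly_Mapping.lookup a i" .
  qed
  finally show False
    using phi(2) by simp
qed

lemma kernel_lattice_frag_cmul_sum:
  fixes m :: nat
  assumes "\<And>j. j < m \<Longrightarrow> b j \<in> kernel_lattice (n + k) mu"
  shows "(\<Sum>j<m. frag_cmul (f j) (b j)) \<in> kernel_lattice (n + k) mu"
proof -
  let ?K = "kernel_lattice (n + k) mu"
  have add: "u + v \<in> ?K" if "u \<in> ?K" "v \<in> ?K" for u v
    using that by (simp add: kernel_lattice_def vecs_add mu_add)
  have diff: "u - v \<in> ?K" if "u \<in> ?K" "v \<in> ?K" for u v
    using that by (simp add: kernel_lattice_def vecs_diff mu_diff)
  have cmul: "frag_cmul c u \<in> ?K" if u: "u \<in> ?K" for c u
  proof (induction c rule: int_induct[where ?k = 0])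
    case base
    show ?case using diff[OF u u] by simp
  next
    case (step1 c)
    then show ?case using add u by (simp add: frag_cmul_distrib)
  next
    case (step2 c)
    then show ?case using diff u by (simp add: frag_cmul_diff_distrib)
  qed
  show ?thesis
    using assms
  proof (induction m)
    case 0
    show ?case using mu_diff[of 0 0] by (simp add: kernel_lattice_def vecs_def)
  qed (simp add: add cmul)
qed

text \<open>Compactness of the torus: modulo the lattice, the coordinates of \<open>a\<close> can be
  replaced by their fractional parts, after which the floors range over a bounded set of integer
  vectors.\<close>

lemma finite_im_Phi: "finite (im_Phi (n + k) mu)"
proof -
  let ?N = "n + k"
  obtain b :: "nat \<Rightarrow> nat \<Rightarrow>\<^sub>0 int" where b: "b ` {..<n} \<subseteq> kernel_lattice ?N mu"
    and unique: "\<forall>m\<in>kernel_lattice ?N mu. \<exists>!c. c \<in> vecs n \<and>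
      m = (\<Sum>j<n. frag_cmul (Poly_Mapping.lookup c j) (b j))"
    using kernel_rank by (elim exE conjE) (rule that)
  have gen: "\<exists>c. m = (\<Sum>j<n. frag_cmul (Poly_Mapping.lookup c j) (b j))" if "m \<in> kernel_lattice ?N mu" for m
    using ex1_implies_ex[OF bspec[OF unique that]] by (elim exE conjE) (rule exI)
  \<comment> \<open>The double sum bounds every entry of a combination of the \<open>b j\<close>
    with coefficients in \<open>[0,1)\<close>; the added 1 leaves room for the floor.\<close>
  define C :: int where "C = 1 + (\<Sum>j<n. \<Sum>i<?N. \<bar>Poly_Mapping.lookup (b j) i\<bar>)"
  let ?F = "{w \<in> vecs ?N. \<forall>i<?N. \<bar>Poly_Mapping.lookup w i\<bar> \<le> C}"
  let ?R = "{\<Sum>j<n. t j *\<^sub>R real_vec (b j) | t. True}"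
  have R_I: "(\<Sum>j<n. t j *\<^sub>R real_vec (b j)) \<in> ?R" for t
    by (rule CollectI, rule exI[of _ t]) simp
  have "subspace ?R"
  proof (rule subspaceI)
    show "0 \<in> ?R"
      using R_I[of "\<lambda>_. 0"] by simp
    show "x + y \<in> ?R" if xy: "x \<in> ?R" "y \<in> ?R" for x y
    proof -
      obtain t t' where "x = (\<Sum>j<n. t j *\<^sub>R real_vec (b j))" "y = (\<Sum>j<n. t' j *\<^sub>R real_vec (b j))"
        using xy by blast
      then have "x + y = (\<Sum>j<n. (t j + t' j) *\<^sub>R real_vec (b j))"
        by (simp add: scaleR_add_left sum.distrib)
      then show ?thesis by (simp only: R_I)
    qed
    show "c *\<^sub>R x \<in> ?R" if x: "x \<in> ?R" for c x
    proof -
      obtain t where "x = (\<Sum>j<n. t j *\<^sub>R real_vec (b j))"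
        using x by blast
      then have "c *\<^sub>R x = (\<Sum>j<n. (c * t j) *\<^sub>R real_vec (b j))"
        by (simp add: scaleR_sum_right)
      then show ?thesis by (simp only: R_I)
    qed
  qed
  moreover have "real_vec ` kernel_lattice ?N mu \<subseteq> ?R"
  proof
    fix x assume "x \<in> real_vec ` kernel_lattice ?N mu"
    then obtain c where "x = real_vec (\<Sum>j<n. frag_cmul (Poly_Mapping.lookup c j) (b j))"
      using gen by blast
    also have "\<dots> = (\<Sum>j<n. real_of_int (Poly_Mapping.lookup c j) *\<^sub>R real_vec (b j))"
      by (rule poly_mapping_eqI) (simp add: lookup_sum)
    finally show "x \<in> ?R" by (simp only: R_I)
  qed
  ultimately have span: "span (real_vec ` kernel_lattice ?N mu) \<subseteq> ?R"
    by (intro span_minimal)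
  have "Phi mu a \<in> (\<lambda>w. mu (- w)) ` ?F" if a: "a \<in> kernel_real ?N mu" for a
  proof -
    obtain t where t: "a = (\<Sum>j<n. t j *\<^sub>R real_vec (b j))"
      using kernel_real_subset_span[OF a] span by blast
    \<comment> \<open>Integer parts of the coordinates: \<open>z\<close> lies in the lattice kernel,
      so subtracting it does not affect \<open>Phi\<close>.\<close>
    define z where "z = (\<Sum>j<n. frag_cmul \<lfloor>t j\<rfloor> (b j))"
    define w where "w = Poly_Mapping.map floor a - z"
    have "z \<in> kernel_lattice ?N mu"
      unfolding z_def using b by (intro kernel_lattice_frag_cmul_sum) blast
    then have z: "z \<in> vecs ?N" "mu z = 0"
      by (simp_all add: kernel_lattice_def)
    have "Poly_Mapping.keys (Poly_Mapping.map floor a) \<subseteq> Poly_Mapping.keys a"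
      by (auto simp: in_keys_iff map.rep_eq when_def)
    then have fl: "Poly_Mapping.map floor a \<in> vecs ?N"
      using a by (auto simp: kernel_real_def vecs_def)
    have w: "w \<in> vecs ?N"
      using fl z by (simp add: w_def vecs_diff)
    have "\<bar>Poly_Mapping.lookup w i\<bar> \<le> C" if i: "i < ?N" for i
    proof -
      let ?x = "\<Sum>j<n. frac (t j) * real_of_int (Poly_Mapping.lookup (b j) i)"
      have ai: "Poly_Mapping.lookup a i = ?x + real_of_int (Poly_Mapping.lookup z i)"
        by (simp add: t z_def lookup_sum frac_def algebra_simps flip: sum.distrib)
      have "Poly_Mapping.lookup (Poly_Mapping.map floor a) i = \<lfloor>Poly_Mapping.lookup a i\<rfloor>"
        by (simp add: map.rep_eq when_def)
      then have wi: "Poly_Mapping.lookup w i = \<lfloor>?x\<rfloor>"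
        by (simp add: w_def lookup_minus ai)
      have "\<bar>?x\<bar> \<le> (\<Sum>j<n. real_of_int \<bar>Poly_Mapping.lookup (b j) i\<bar>)"
      proof (rule order_trans[OF sum_abs sum_mono])
        fix j
        show "\<bar>frac (t j) * real_of_int (Poly_Mapping.lookup (b j) i)\<bar> \<le> real_of_int \<bar>Poly_Mapping.lookup (b j) i\<bar>"
          using frac_lt_1[of "t j"] frac_ge_0[of "t j"]
          by (simp add: abs_mult mult_left_le_one_le)
      qed
      also have "\<dots> \<le> (\<Sum>j<n. real_of_int (\<Sum>i<?N. \<bar>Poly_Mapping.lookup (b j) i\<bar>))"
        using i by (intro sum_mono of_int_le_iff[THEN iffD2] member_le_sum) auto
      also have "\<dots> = real_of_int (C - 1)"
        by (simp add: C_def)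
      finally have "\<bar>?x\<bar> \<le> real_of_int (C - 1)" .
      then show ?thesis
        unfolding wi by linarith
    qed
    moreover have "Phi mu a = mu (- w)"
    proof -
      have "- Poly_Mapping.map floor a = - w - z"
        by (simp add: w_def)
      then show ?thesis
        using w z by (simp add: Phi_def mu_diff vecs_uminus)
    qed
    ultimately show ?thesis
      using w by blast
  qed
  then have "im_Phi ?N mu \<subseteq> (\<lambda>w. mu (- w)) ` ?F"
    by (auto simp: im_Phi_def)
  then show ?thesis
    by (rule finite_subset) (intro finite_imageI finite_bounded_vecs)
qed

end


section \<open>Sorted paths\<close>

lemma is_path_append:
  "is_path N mu v as w \<Longrightarrow> is_path N mu w bs z \<Longrightarrow> is_path N mu v (as @ bs) z"
  by (induction as arbitrary: v) auto

lemma path_expo_simps [simp]: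
  "path_expo [] = 0" "path_expo (a # as) = expo a + path_expo as"
  "path_expo (as @ bs) = path_expo as + path_expo bs"
  by (simp_all add: path_expo_def)

lemma total_degree_pos: "u \<noteq> 0 \<Longrightarrow> 0 < total_degree u"
  unfolding total_degree_def
  by (rule sum_pos) (auto simp: in_keys_iff simp flip: keys_eq_empty)

text \<open>A morphism with nonzero exponent that is not an arrow splits into two of smaller total
  degree; exponent 0 forces equal ends and gives the empty path.\<close>

lemma mono_mor_path:
  assumes "mu 0 = 0" "p \<in> mono_mors N mu"
  shows "\<exists>as. is_path N mu (src p) as (tgt p) \<and> path_expo as = expo p"
  using assms(2)
proof (induction "total_degree (expo p)" arbitrary: p rule: less_induct)
  case less
  have V: "src p \<in> im_Phi N mu" "tgt p \<in> im_Phi N mu"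
    and mu: "mu (Poly_Mapping.map int (expo p)) = src p - tgt p"
    using less.prems by (auto simp: mono_mors_def)
  consider "expo p = 0" | "p \<in> arrows N mu" | q r where "q \<in> mono_mors N mu" "r \<in> mono_mors N mu"
      "expo q \<noteq> 0" "expo r \<noteq> 0" "tgt q = src r" "p = concat_mor q r"
    using less.prems unfolding arrows_def by blast
  then show ?case
  proof cases
    case 1
    have "Poly_Mapping.map int 0 = (0 :: nat \<Rightarrow>\<^sub>0 int)"
      by (rule poly_mapping_eqI) (simp add: map.rep_eq)
    then have "src p = tgt p"
      using 1 mu assms(1) by simp
    then show ?thesis
      using 1 V by (intro exI[of _ "[]"]) simp
  next
    case 2
    then show ?thesis
      using V by (intro exI[of _ "[p]"]) simp
  next
    case 3
    have "total_degree (expo q) < total_degree (expo p)" "total_degree (expo r) < total_degree (expo p)"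
      using 3 total_degree_pos by (simp_all add: total_degree_add)
    then obtain as bs where "is_path N mu (src q) as (tgt q)" "path_expo as = expo q"
        "is_path N mu (src r) bs (tgt r)" "path_expo bs = expo r"
      using less.hyps 3(1,2) by metis
    then show ?thesis
      using 3 is_path_append by (intro exI[of _ "as @ bs"]) auto
  qed
qed

lemma spells_Cons: "spells (a # as) js \<longleftrightarrow>
    (\<exists>i is. js = i # is \<and> expo a = Poly_Mapping.single i 1 \<and> spells as is)"
  by (auto simp: spells_def Cons_eq_map_conv map_eq_Cons_conv)

lemma keys_path_expo: "spells as is \<Longrightarrow> Poly_Mapping.keys (path_expo as) = set is"
proof (induction as arbitrary: "is")
  case (Cons a as)
  then show ?case
    by (auto simp: spells_Cons keys_add_nat)
qed (simp add: spells_def)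

section \<open>Quivers whose arrows are variables\<close>

context
  fixes N :: nat and mu :: "(nat \<Rightarrow>\<^sub>0 int) \<Rightarrow> 'g::ab_group_add"
  assumes arrows_var: "\<And>a. a \<in> arrows N mu \<Longrightarrow> \<exists>i. expo a = Poly_Mapping.single i 1"
begin

lemma total_degree_path: "is_path N mu v as w \<Longrightarrow> total_degree (path_expo as) = length as"
  by (induction as arbitrary: v) (auto simp: total_degree_add dest!: arrows_var)

lemma path_spells: "is_path N mu v as w \<Longrightarrow> \<exists>is. spells as is"
proof (induction as arbitrary: v)
  case (Cons a as)
  then show ?case
    using arrows_var[of a] by (fastforce simp: spells_Cons)
qed (auto simp: spells_def)

text \<open>Each arrow adds one to the total degree, so the exponent of a path determines its
  length.\<close>

lemma homogeneous_relations_if_arrows_var: "homogeneous_relations N mu"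
  unfolding homogeneous_relations_def by (metis total_degree_path)

lemma path_length_eq_total_degree:
  assumes "mu 0 = 0" "p \<in> mono_mors N mu"
  shows "path_length N mu p = total_degree (expo p)"
proof -
  obtain as where as: "is_path N mu (src p) as (tgt p)" "path_expo as = expo p"
    using mono_mor_path[OF assms] by blast
  show ?thesis
    unfolding path_length_def
  proof (rule Least_equality)
    show "\<exists>as. is_path N mu (src p) as (tgt p) \<and> path_expo as = expo p \<and> length as = total_degree (expo p)"
      using as total_degree_path by metis
    show "total_degree (expo p) \<le> d"
      if "\<exists>as. is_path N mu (src p) as (tgt p) \<and> path_expo as = expo p \<and> length as = d" for d
      using that total_degree_path by (metis order_refl)
  qed
qed

end

text \<open>A sorted path for \<open>p\<close> uses the same variables, so it must start with the
  least of them; the end of its first arrow is the required vertex.\<close>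

lemma directed_first_step:
  fixes mu :: "(nat \<Rightarrow>\<^sub>0 int) \<Rightarrow> 'g::ab_group_add"
  assumes arrows_var: "\<And>a. a \<in> arrows N mu \<Longrightarrow> \<exists>i. expo a = Poly_Mapping.single i 1"
    and sort: "\<And>v w as is. is_path N mu v as w \<Longrightarrow> spells as is \<Longrightarrow>
      \<exists>bs js. is_path N mu v bs w \<and> spells bs js \<and> path_expo bs = path_expo as \<and> sorted (map s js)"
    and "inj s" "mu 0 = 0" and p: "p \<in> mono_mors N mu" and i: "i \<in> Poly_Mapping.keys (expo p)"
    and least: "\<And>j. j \<in> Poly_Mapping.keys (expo p) \<Longrightarrow> s i \<le> s j"
  shows "src p - mu (Poly_Mapping.single i 1) \<in> im_Phi N mu"
proof -
  obtain as where as: "is_path N mu (src p) as (tgt p)" "path_expo as = expo p"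
    using mono_mor_path[OF assms(4) p] by blast
  moreover obtain "is" where "spells as is"
    using path_spells[OF arrows_var as(1)] by blast
  ultimately obtain bs js where bs: "is_path N mu (src p) bs (tgt p)" "spells bs js"
      "path_expo bs = expo p" "sorted (map s js)"
    using sort by metis
  have keys: "Poly_Mapping.keys (expo p) = set js"
    using keys_path_expo[OF bs(2)] bs(3) by simp
  then obtain b bs' where b: "bs = b # bs'"
    using i bs(2) by (cases bs) (auto simp: spells_def)
  then obtain j js' where j: "js = j # js'" "expo b = Poly_Mapping.single j 1"
    using bs(2) by (auto simp: spells_Cons)
  \<comment> \<open>One inequality comes from sortedness, as \<open>i\<close> occurs in
    \<open>js\<close>; the other from minimality of \<open>i\<close>.\<close>
  have "s i = s j"
    using least[of j] i bs(4) by (auto simp: keys j(1))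
  then have "i = j"
    using \<open>inj s\<close> by (simp add: inj_eq)
  have "b \<in> mono_mors N mu" "src b = src p"
    using bs(1) by (auto simp: b arrows_def)
  then have "tgt b \<in> im_Phi N mu" "mu (Poly_Mapping.single j 1) = src p - tgt b"
    using j(2) by (auto simp: mono_mors_def)
  then show ?thesis
    using \<open>i = j\<close> by simp
qed

theorem corollary6p33:
  fixes n k :: nat
    and mu :: "(nat \<Rightarrow>\<^sub>0 int) \<Rightarrow> 'g::ab_group_add"
  assumes "noetherian TYPE('r::comm_ring_1)"
    and "toric_stack n k mu"
    and "cohomologically_proper (n + k) mu"
    and "directable (n + k) mu"
  shows "koszul TYPE('r) (n + k) mu"
proof -
  interpret toric_stack n k mu by fact
  have mu_0: "mu 0 = 0"
    using mu_diff[of 0 0] by (simp add: vecs_def)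
  have arrows_var: "\<exists>i. expo a = Poly_Mapping.single i 1" if "a \<in> arrows (n + k) mu" for a
    using that assms(4) unfolding directable_def by blast
  obtain s where s: "s permutes {..<n + k}"
    and sort: "\<And>v w as is. is_path (n + k) mu v as w \<Longrightarrow> spells as is \<Longrightarrow>
      \<exists>bs js. is_path (n + k) mu v bs w \<and> spells bs js \<and> path_expo bs = path_expo as \<and>
        mset js = mset is \<and> sorted (map s js)"
    using assms(4) unfolding directable_def by blast
  \<comment> \<open>Outside \<open>{..<n + k}\<close> the permutation is the identity, so it is
    injective on all naturals.\<close>
  have "inj s"
    using s by (rule permutes_inj)
  interpret directed_monomials "n + k" mu s
  proof
    show "mu (u + v) = mu u + mu v" if "u \<in> vecs (n + k)" "v \<in> vecs (n + k)" for u v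
      using that by (rule mu_add)
    show "finite (im_Phi (n + k) mu)"
      by (rule finite_im_Phi)
    show "path_length (n + k) mu p = total_degree (expo p)" if "p \<in> mono_mors (n + k) mu" for p
      using arrows_var mu_0 that by (rule path_length_eq_total_degree)
    show "src p - mu (Poly_Mapping.single i 1) \<in> im_Phi (n + k) mu"
      if "p \<in> mono_mors (n + k) mu" "i \<in> Poly_Mapping.keys (expo p)"
        "\<And>j. j \<in> Poly_Mapping.keys (expo p) \<Longrightarrow> s i \<le> s j" for p i
      by (rule directed_first_step[OF arrows_var _ \<open>inj s\<close> mu_0 that]) (use sort in blast)+
  qed fact
  show ?thesis
    using homogeneous_relations_if_arrows_var[OF arrows_var] by (rule koszul_if_homogeneous)
qed

end
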